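(* Let $k \geq 2$ be a fixed integer. Then $A_k(c)$ is a monotone nonincreasing, piecewise linear and right continuous function of $c \in (0,1]$. Its points of discontinuity are all rational and are contained in a sequence $1=c_0>c_1>c_2>\cdots$ with $c_i \to 0$.
   Context: A hypergraph $\mathcal{H}=\{H_1,\ldots,H_m\}$ on a finite vertex set $V$ is a family of nonempty subsets of $V$ (its hyperedges). It is $k$-intersecting if $|H\cap H'|\ge k$ for all distinct $H,H'\in\mathcal{H}$. Its fractional matching number $\nu^*(\mathcal{H})$ is the maximum of $\sum_{i=1}^m f_i$ over all $f_1,\ldots,f_m\ge 0$ with $\sum_{i:x\in H_i} f_i\le 1$ for every $x\in V$. For a real $c>0$, $a(\mathcal{H},c)$ is the minimum of $\sum_{i=1}^m |H_i|\,y_i$ over all $(y_1,\ldots,y_m)$ with $y_i\ge 0$ for all $i$, $\sum_{i=1}^m y_i=1$, and $\sum_{i:x\in H_i} y_i\le c$ for every $x\in V$; this linear program is feasible if and only if $c\ge 1/\nu^*(\mathcal{H})$. For a positive integer $k$ and real $c>0$, $$A_k(c)=\inf\{a(\mathcal{H},c): \mathcal{H}\text{ is a } k\text{-intersecting hypergraph with } 1/\nu^*(\mathcal{H})\le c\}.$$ *)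

theory Defs
  imports "HOL-Analysis.Analysis"
begin

text \<open>
  A hypergraph is a finite vertex set \<open>V\<close> with a set \<open>E\<close> of nonempty subsets of \<open>V\<close>.
  The family \<open>H\<^sub>1, \<dots>, H\<^sub>m\<close> has \<open>m \<ge> 1\<close>: for the empty family \<open>\<nu>\<^sup>* = 0\<close>, the linear program
  defining \<open>a\<close> is infeasible for every \<open>c\<close>, and \<open>1 / \<nu>\<^sup>*\<close> has to be read as infinity,
  whereas \<open>1 / 0 = 0\<close> in HOL.
\<close>

definition hypergraph :: "'a set \<Rightarrow> 'a set set \<Rightarrow> bool" where
  "hypergraph V E \<longleftrightarrow> finite V \<and> E \<noteq> {} \<and> (\<forall>H\<in>E. H \<noteq> {} \<and> H \<subseteq> V)"

definition intersecting :: "nat \<Rightarrow> 'a set set \<Rightarrow> bool" where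
  "intersecting k E \<longleftrightarrow> (\<forall>H\<in>E. \<forall>H'\<in>E. H \<noteq> H' \<longrightarrow> card (H \<inter> H') \<ge> k)"

definition fractional_matching :: "'a set \<Rightarrow> 'a set set \<Rightarrow> ('a set \<Rightarrow> real) \<Rightarrow> bool" where
  "fractional_matching V E f \<longleftrightarrow>
     (\<forall>H\<in>E. f H \<ge> 0) \<and> (\<forall>x\<in>V. (\<Sum>H\<in>{H\<in>E. x \<in> H}. f H) \<le> 1)"

text \<open>
  The supremum is a maximum for every hypergraph: the edges are nonempty, so the feasible
  weights on \<open>E\<close> form a nonempty compact polytope.
\<close>

definition fractional_matching_number :: "'a set \<Rightarrow> 'a set set \<Rightarrow> real" where
  "fractional_matching_number V E = (SUP f \<in> {f. fractional_matching V E f}. \<Sum>H\<in>E. f H)"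

definition feasible_weighting :: "'a set \<Rightarrow> 'a set set \<Rightarrow> real \<Rightarrow> ('a set \<Rightarrow> real) \<Rightarrow> bool" where
  "feasible_weighting V E c y \<longleftrightarrow>
     (\<forall>H\<in>E. y H \<ge> 0) \<and> (\<Sum>H\<in>E. y H) = 1 \<and> (\<forall>x\<in>V. (\<Sum>H\<in>{H\<in>E. x \<in> H}. y H) \<le> c)"

text \<open>
  The infimum is a minimum whenever the program is feasible, that is, for
  \<open>c \<ge> 1 / \<nu>\<^sup>*\<close>; otherwise the value is unspecified, and it is not used below.
\<close>

definition a_value :: "'a set \<Rightarrow> 'a set set \<Rightarrow> real \<Rightarrow> real" where
  "a_value V E c = (INF y \<in> {y. feasible_weighting V E c y}. \<Sum>H\<in>E. real (card H) * y H)"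

text \<open>
  All quantities are invariant under renaming vertices, so it is no restriction to let the
  finite vertex sets range over finite sets of natural numbers.
\<close>

definition A_fun :: "nat \<Rightarrow> real \<Rightarrow> real" where
  "A_fun k c = Inf {a_value V E c | (V :: nat set) E.
     hypergraph V E \<and> intersecting k E \<and> 1 / fractional_matching_number V E \<le> c}"

text \<open>
  \<open>f\<close> is affine on each open interval of \<open>S\<close> that avoids a set \<open>B\<close> of breakpoints, and each
  compact subinterval of \<open>S\<close> contains only finitely many breakpoints. For \<open>S = (0, 1]\<close> the
  breakpoints can thus accumulate only at \<open>0\<close>. Jumps at breakpoints are allowed.
\<close>

definition piecewise_linear_on :: "real set \<Rightarrow> (real \<Rightarrow> real) \<Rightarrow> bool" where
  "piecewise_linear_on S f \<longleftrightarrow>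
     (\<exists>B. (\<forall>a b. {a..b} \<subseteq> S \<longrightarrow> finite (B \<inter> {a..b})) \<and>
          (\<forall>a b. {a<..<b} \<subseteq> S - B \<longrightarrow> (\<exists>p q. \<forall>x\<in>{a<..<b}. f x = p * x + q)))"

end

theory Submission
  imports Defs
begin

text \<open>
  Fix \<open>0 < e\<close>. On \<open>[e, 1]\<close> the infimum defining \<open>A_fun k\<close> needs only finitely many hypergraphs,
  and from each of them only finitely many weightings that are affine in \<open>c\<close>.

  \<^item> An optimal weighting can be taken to be a basic solution of the linear program, one that is
    determined by its zero weights and its saturated vertices (\<open>basic_weighting_exists\<close>). Then the
    support has at most one edge more than there are saturated vertices. As the loads add up to the
    cost, at most \<open>cost / c\<close> vertices are saturated, so the number of edges in the support is
    bounded on \<open>[e, 1]\<close> (\<open>basic_weighting_support\<close>).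
  \<^item> With boundedly many edges, keep only \<open>k\<close> common vertices of each pair of edges and one vertex of
    each edge. The traces of the edges still intersect in \<open>k\<close> vertices, and neither cost nor loads
    grow. After renaming, the vertex set is a fixed finite set (\<open>bounded_vertex_set\<close>).
  \<^item> For fixed sets of zero weights and saturated vertices that determine the weighting, the
    weighting is an affine function of \<open>c\<close> (\<open>determined_affine\<close>), and the \<open>c\<close> for which it is
    feasible form a compact interval within \<open>[e, 1]\<close>.

  So on \<open>[e, 1]\<close> the function is attained at each point and is the lower envelope of finitely many
  closed segments (\<open>A_fun_envelope\<close>). Such an envelope is piecewise affine and lower semicontinuous;
  since larger capacities admit more weightings, the function is also nonincreasing, and both
  together give right continuity. Outside the breakpoints it is continuous, and the breakpoints
  accumulate only at \<open>0\<close>, so they can be listed in decreasing order.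

  For the rationality of the discontinuities, let \<open>y\<close> be an optimal weighting at \<open>c\<close>. If its
  hypergraph is feasible for some \<open>c' < c\<close>, then convex combinations with \<open>y\<close> show left continuity at
  \<open>c\<close> (\<open>A_fun_continuous_if_slack\<close>). Hence at a discontinuity \<open>c\<close> is the least feasible capacity of
  a hypergraph, the optimum of a linear program with integer coefficients, and therefore rational
  (\<open>minimal_capacity_rational\<close>).
\<close>

section \<open>Linear algebra\<close>

text \<open>
  Gaussian elimination: if \<open>a t r \<noteq> 0\<close>, the equation \<open>t\<close> is used to eliminate the unknown \<open>r\<close> from
  the other equations.
\<close>
lemma homogeneous_system_nontrivial:
  fixes a :: "'t \<Rightarrow> 's \<Rightarrow> real"
  assumes "finite T" "finite S" "card T < card S"
  shows "\<exists>z. (\<exists>s\<in>S. z s \<noteq> 0) \<and> (\<forall>t\<in>T. (\<Sum>s\<in>S. a t s * z s) = 0)"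
  using assms
proof (induction T arbitrary: S a rule: finite_induct)
  case empty
  then have "S \<noteq> {}" by auto
  then show ?case by (intro exI[of _ "\<lambda>_. 1"]) auto
next
  case (insert t T)
  show ?case
  proof (cases "\<forall>s\<in>S. a t s = 0")
    case True
    have "card T < card S" using insert.hyps insert.prems by simp
    from insert.IH[OF insert.prems(1) this, of a] True show ?thesis by auto
  next
    case False
    then obtain r where r: "r \<in> S" "a t r \<noteq> 0" by auto
    define R where "R = S - {r}"
    have R: "finite R" "card T < card R" "r \<notin> R"
      using insert.hyps insert.prems r by (auto simp: R_def)
    have split: "(\<Sum>s\<in>S. f s) = f r + (\<Sum>s\<in>R. f s)" for f :: "'s \<Rightarrow> real"
      unfolding R_def using insert.prems(1) r(1) by (simp add: sum.remove)
    obtain z where z: "\<exists>s\<in>R. z s \<noteq> 0"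
      "\<forall>t'\<in>T. (\<Sum>s\<in>R. (a t' s - a t' r * a t s / a t r) * z s) = 0"
      using insert.IH[OF R(1,2), of "\<lambda>t' s. a t' s - a t' r * a t s / a t r"] by blast
    define w where "w = z(r := - (\<Sum>s\<in>R. a t s * z s) / a t r)"
    have wR: "(\<Sum>s\<in>R. b s * w s) = (\<Sum>s\<in>R. b s * z s)" for b
      using R(3) by (intro sum.cong) (auto simp: w_def)
    have "(\<Sum>s\<in>S. a t s * w s) = 0"
      using r(2) by (simp add: split wR) (simp add: w_def)
    moreover have "(\<Sum>s\<in>S. a t' s * w s) = 0" if "t' \<in> T" for t'
    proof -
      have "(\<Sum>s\<in>S. a t' s * w s) = a t' r * w r + (\<Sum>s\<in>R. a t' s * z s)"
        by (simp add: split wR)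
      also have "\<dots> = (\<Sum>s\<in>R. (a t' s - a t' r * a t s / a t r) * z s)"
        by (simp add: w_def left_diff_distrib sum_subtractf sum_distrib_left sum_divide_distrib
            mult.assoc)
      finally show ?thesis using z(2) that by simp
    qed
    moreover have "\<exists>s\<in>S. w s \<noteq> 0"
      using z(1) R(3) by (auto simp: w_def R_def)
    ultimately show ?thesis by auto
  qed
qed

text \<open>
  The step length of the simplex method: increasing \<open>t\<close> until the first of the constraints
  \<open>0 \<le> s i + t * d i\<close> becomes tight. No constraint that is tight at the start is affected.
\<close>
lemma ratio_test:
  fixes s d :: "'i \<Rightarrow> real"
  assumes "finite I" and s: "\<And>i. i \<in> I \<Longrightarrow> 0 \<le> s i" and d: "\<And>i. i \<in> I \<Longrightarrow> s i = 0 \<Longrightarrow> d i = 0"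
    and j: "j \<in> I" "d j < 0"
  obtains t where "0 < t" "\<And>i. i \<in> I \<Longrightarrow> 0 \<le> s i + t * d i"
    "\<exists>i\<in>I. s i \<noteq> 0 \<and> s i + t * d i = 0"
proof -
  define N where "N = {i\<in>I. d i < 0}"
  define t where "t = Min ((\<lambda>i. s i / - d i) ` N)"
  have N: "finite N" "N \<noteq> {}" using assms by (auto simp: N_def)
  have pos: "0 < s i" if "i \<in> N" for i
    using s[of i] d[of i] that by (force simp: N_def)
  obtain m where m: "m \<in> N" "t = s m / - d m"
    using Min_in[of "(\<lambda>i. s i / - d i) ` N"] N by (fastforce simp only: t_def image_iff
        finite_imageI image_is_empty)
  have dm: "d m < 0" using m by (simp add: N_def)
  have "0 < t" using pos[OF m(1)] dm unfolding m(2) by (intro divide_pos_pos) auto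
  moreover have "0 \<le> s i + t * d i" if "i \<in> I" for i
  proof (cases "d i < 0")
    case True
    then have "t \<le> s i / - d i"
      unfolding t_def using N that by (intro Min_le) (auto simp: N_def)
    then have "t * - d i \<le> s i" using True by (simp only: pos_le_divide_eq neg_0_less_iff_less)
    then show ?thesis by simp
  next
    case False
    then show ?thesis using s[OF that] \<open>0 < t\<close> by simp
  qed
  moreover have "s m + t * d m = 0" using m(2) dm by (simp add: field_simps)
  then have "\<exists>i\<in>I. s i \<noteq> 0 \<and> s i + t * d i = 0"
    using m(1) pos[OF m(1)] unfolding N_def by (intro bexI[of _ m]) auto
  ultimately show thesis using that by blast
qed

text \<open>
  Over the rationals, \<open>1\<close> and an irrational \<open>c\<close> are linearly independent, so a rational linear map
  may fix \<open>1\<close> and send \<open>c\<close> to \<open>0\<close>. Such a map carries a solution of a linear system with integer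
  coefficients to another solution.
\<close>
lemma additive_function_moving_irrational:
  fixes c :: real
  assumes "c \<notin> \<rat>"
  obtains \<phi> :: "real \<Rightarrow> real" where "Modules.additive \<phi>" "\<phi> 1 = 1" "\<phi> c \<noteq> c"
proof -
  interpret Q: vector_space "\<lambda>(q::rat) (x::real). of_rat q * x"
    by unfold_locales (auto simp: algebra_simps of_rat_add of_rat_mult)
  interpret QQ: vector_space_pair "\<lambda>(q::rat) (x::real). of_rat q * x"
    "\<lambda>(q::rat) (x::real). of_rat q * x" ..
  have c: "c \<noteq> 1" "c \<noteq> 0" using assms by auto
  have "c \<notin> Q.span {1}"
    using assms by (auto simp: Q.span_singleton)
  then have "Q.independent {c, 1}"
    by (intro Q.independent_insertI) (auto simp: Q.independent_empty)
  from QQ.linear_independent_extend[OF this, of "\<lambda>x. if x = 1 then 1 else 0"]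
  obtain \<phi> where lin: "Vector_Spaces.linear (\<lambda>q (x::real). of_rat q * x) (\<lambda>q (x::real). of_rat q * x) \<phi>"
    and val: "\<forall>x\<in>{c, 1}. \<phi> x = (if x = 1 then 1 else 0)" by blast
  have "Modules.additive \<phi>"
    using lin by (auto simp: Vector_Spaces.linear_iff intro: additive.intro)
  then show thesis using that[of \<phi>] val c by auto
qed

section \<open>Slacks and basic weightings\<close>

definition load :: "'a set set \<Rightarrow> ('a set \<Rightarrow> real) \<Rightarrow> 'a \<Rightarrow> real" where
  "load E y x = (\<Sum>H\<in>{H\<in>E. x \<in> H}. y H)"

definition cost :: "'a set set \<Rightarrow> ('a set \<Rightarrow> real) \<Rightarrow> real" where
  "cost E y = (\<Sum>H\<in>E. real (card H) * y H)"

text \<open>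
  The weights and the unused capacities of the vertices are treated alike, as the values that have
  to be nonnegative. As \<open>slack\<close> is jointly linear in \<open>c\<close> and \<open>y\<close>, the same function with \<open>d\<close> and
  \<open>z\<close> in their place describes how the constraints change in a direction \<open>(d, z)\<close>.
\<close>
definition slack :: "'a set set \<Rightarrow> real \<Rightarrow> ('a set \<Rightarrow> real) \<Rightarrow> 'a set + 'a \<Rightarrow> real" where
  "slack E c y i = (case i of Inl H \<Rightarrow> y H | Inr x \<Rightarrow> c - load E y x)"

lemma slack_simps [simp]:
  "slack E c y (Inl H) = y H" "slack E c y (Inr x) = c - load E y x"
  by (simp_all add: slack_def)

lemma feasible_iff_slack:
  "feasible_weighting V E c y \<longleftrightarrow> sum y E = 1 \<and> (\<forall>i\<in>E <+> V. 0 \<le> slack E c y i)"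
  by (auto simp: feasible_weighting_def load_def Ball_def all_conj_distrib Plus_def)

lemma load_affine: "load E (\<lambda>H. y H + t * z H) x = load E y x + t * load E z x"
  by (simp add: load_def sum.distrib sum_distrib_left)

lemma cost_affine: "cost E (\<lambda>H. y H + t * z H) = cost E y + t * cost E z"
  by (simp add: cost_def sum.distrib sum_distrib_left algebra_simps)

lemma slack_affine:
  "slack E (c + t * d) (\<lambda>H. y H + t * z H) i = slack E c y i + t * slack E d z i"
  by (cases i) (simp_all add: load_affine algebra_simps)

lemma load_cong: "(\<And>H. H \<in> E \<Longrightarrow> y H = z H) \<Longrightarrow> load E y x = load E z x"
  unfolding load_def by (intro sum.cong) auto

lemma cost_cong: "(\<And>H. H \<in> E \<Longrightarrow> y H = z H) \<Longrightarrow> cost E y = cost E z"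
  unfolding cost_def by (intro sum.cong) auto

lemma feasible_cong:
  assumes "\<And>H. H \<in> E \<Longrightarrow> y H = z H"
  shows "feasible_weighting V E c y \<longleftrightarrow> feasible_weighting V E c z"
proof -
  have "sum y E = sum z E" using assms by (intro sum.cong) auto
  moreover have "slack E c y i = slack E c z i" if "i \<in> E <+> V" for i
    using that assms load_cong[of E y z] by auto
  ultimately show ?thesis by (auto simp: feasible_iff_slack)
qed

lemma feasible_mono:
  "feasible_weighting V E c y \<Longrightarrow> c \<le> c' \<Longrightarrow> feasible_weighting V E c' y"
  by (force simp: feasible_weighting_def)

lemma hypergraph_finite: "hypergraph V E \<Longrightarrow> finite V \<and> finite E"
  by (meson PowI finite_Pow_iff finite_subset hypergraph_def subsetI)

lemma sum_load:
  assumes "hypergraph V E"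
  shows "(\<Sum>x\<in>V. load E y x) = cost E y"
proof -
  have fin: "finite V" "finite E" using hypergraph_finite[OF assms] by auto
  have "(\<Sum>x\<in>V. load E y x) = (\<Sum>x\<in>V. \<Sum>H\<in>E. if x \<in> H then y H else 0)"
    unfolding load_def by (simp add: sum.If_cases[OF fin(2)] Int_def conj_commute)
  also have "\<dots> = (\<Sum>H\<in>E. \<Sum>x\<in>V. if x \<in> H then y H else 0)" by (rule sum.swap)
  also have "\<dots> = cost E y"
    unfolding cost_def
  proof (intro sum.cong refl)
    fix H assume "H \<in> E"
    then have "V \<inter> {x. x \<in> H} = H" using assms by (auto simp: hypergraph_def)
    then show "(\<Sum>x\<in>V. if x \<in> H then y H else 0) = real (card H) * y H"
      by (simp add: sum.If_cases[OF fin(1)])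
  qed
  finally show ?thesis .
qed

lemma load_nonneg:
  "feasible_weighting V E c y \<Longrightarrow> 0 \<le> load E y x"
  by (auto simp: feasible_weighting_def load_def intro!: sum_nonneg)

lemma cost_nonneg:
  "feasible_weighting V E c y \<Longrightarrow> 0 \<le> cost E y"
  by (auto simp: feasible_weighting_def cost_def intro!: sum_nonneg)

text \<open>
  Uniqueness of the weighting with total weight \<open>1\<close> and zero slacks on \<open>J\<close>, for each capacity, in its
  homogeneous form.
\<close>
definition determined :: "'a set set \<Rightarrow> ('a set + 'a) set \<Rightarrow> bool" where
  "determined E J \<longleftrightarrow>
     (\<forall>z. sum z E = 0 \<longrightarrow> (\<forall>i\<in>J. slack E 0 z i = 0) \<longrightarrow> (\<forall>H\<in>E. z H = 0))"

definition active :: "'a set \<Rightarrow> 'a set set \<Rightarrow> real \<Rightarrow> ('a set \<Rightarrow> real) \<Rightarrow> ('a set + 'a) set" where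
  "active V E c y = {i \<in> E <+> V. slack E c y i = 0}"

text \<open>
  If the active constraints leave a direction \<open>z\<close> free, moving along \<open>z\<close> or \<open>- z\<close> does not increase
  the cost. The total weight is constant, so \<open>z\<close> is negative somewhere, and the move ends when a
  further constraint becomes active. The number of inactive constraints therefore decreases until
  no free direction is left.
\<close>
lemma basic_weighting_exists:
  assumes "finite V" "finite E" "feasible_weighting V E c y"
  obtains y' where "feasible_weighting V E c y'" "cost E y' \<le> cost E y"
    "determined E (active V E c y')"
proof -
  have "\<exists>y'. feasible_weighting V E c y' \<and> cost E y' \<le> cost E y \<and> determined E (active V E c y')"
    using assms(3)
  proof (induction "card {i \<in> E <+> V. slack E c y i \<noteq> 0}" arbitrary: y rule: less_induct)
    case less
    show ?case
    proof (cases "determined E (active V E c y)")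
      case True
      then show ?thesis using less.prems by auto
    next
      case False
      then obtain z0 where z0: "sum z0 E = 0" "\<forall>i\<in>active V E c y. slack E 0 z0 i = 0"
        "\<exists>H\<in>E. z0 H \<noteq> 0" by (auto simp: determined_def)
      \<comment> \<open>The sign makes the direction one of nonincreasing cost.\<close>
      define \<sigma> :: real where "\<sigma> = (if cost E z0 \<le> 0 then 1 else - 1)"
      define z where "z = (\<lambda>H. 0 + \<sigma> * z0 H)"
      have "cost E z \<le> 0"
        unfolding z_def cost_affine by (simp add: \<sigma>_def cost_def)
      moreover have sz: "sum z E = 0"
        using z0(1) by (simp add: z_def flip: sum_distrib_left)
      moreover have act: "slack E 0 z i = 0" if "i \<in> active V E c y" for i
      proof -
        have "slack E (0 + \<sigma> * 0) z i = slack E 0 (\<lambda>_. 0) i + \<sigma> * slack E 0 z0 i"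
          unfolding z_def by (rule slack_affine)
        moreover have "slack E 0 (\<lambda>_. 0) i = 0" by (cases i) (simp_all add: load_def)
        ultimately show ?thesis using z0(2) that by simp
      qed
      moreover have "\<exists>H\<in>E. z H \<noteq> 0" using z0(3) by (auto simp: z_def \<sigma>_def)
      then have "\<exists>H\<in>E. z H < 0"
        using sz assms(2) by (metis not_le sum_nonneg_eq_0_iff)
      then obtain H where H: "H \<in> E" "z H < 0" by blast
      let ?s = "slack E c y" and ?d = "slack E 0 z"
      obtain t where t: "0 < t" "\<And>i. i \<in> E <+> V \<Longrightarrow> 0 \<le> ?s i + t * ?d i"
        "\<exists>i\<in>E <+> V. ?s i \<noteq> 0 \<and> ?s i + t * ?d i = 0"
      proof (rule ratio_test[of "E <+> V" ?s ?d "Inl H"])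
        show "finite (E <+> V)" using assms by simp
        show "0 \<le> ?s i" if "i \<in> E <+> V" for i
          using less.prems that by (simp add: feasible_iff_slack)
        show "?d i = 0" if "i \<in> E <+> V" "?s i = 0" for i
          using act that by (simp add: active_def)
      qed (use H in auto)
      define y1 where "y1 = (\<lambda>H. y H + t * z H)"
      have s1: "slack E c y1 i = ?s i + t * ?d i" for i
        using slack_affine[of E c t 0 y z i] by (simp add: y1_def)
      have f1: "feasible_weighting V E c y1"
        using less.prems t(2) sz
        by (auto simp: feasible_iff_slack s1) (simp add: y1_def sum.distrib flip: sum_distrib_left)
      have c1: "cost E y1 \<le> cost E y"
        unfolding y1_def cost_affine using t(1) \<open>cost E z \<le> 0\<close>
        by (simp add: mult_nonneg_nonpos)
      have "{i \<in> E <+> V. slack E c y1 i \<noteq> 0} \<subset> {i \<in> E <+> V. ?s i \<noteq> 0}"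
      proof (rule psubsetI)
        show "{i \<in> E <+> V. slack E c y1 i \<noteq> 0} \<subseteq> {i \<in> E <+> V. ?s i \<noteq> 0}"
        proof clarify
          fix i assume "i \<in> E <+> V" "slack E c y1 i \<noteq> 0" "?s i = 0"
          then show False using act[of i] by (simp add: s1 active_def)
        qed
        show "{i \<in> E <+> V. slack E c y1 i \<noteq> 0} \<noteq> {i \<in> E <+> V. ?s i \<noteq> 0}"
          using t(3) unfolding s1 by blast
      qed
      then have "card {i \<in> E <+> V. slack E c y1 i \<noteq> 0} < card {i \<in> E <+> V. ?s i \<noteq> 0}"
        using assms by (intro psubset_card_mono) auto
      from less.hyps[OF this f1] c1 show ?thesis by force
    qed
  qed
  then show thesis using that by blast
qed

text \<open>
  A weighting supported on \<open>S\<close> satisfies \<open>1 + card T\<close> equations, where \<open>T\<close> is the set of saturated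
  vertices. If \<open>card S\<close> were larger, these equations would have a nontrivial homogeneous solution.
  Each saturated vertex contributes \<open>c\<close> to the cost, which is the sum of all loads.
\<close>
lemma basic_weighting_support:
  assumes hyp: "hypergraph V E" and feas: "feasible_weighting V E c y" and "0 < c"
    and det: "determined E (active V E c y)"
  shows "real (card {H\<in>E. y H \<noteq> 0}) \<le> 1 + cost E y / c"
proof -
  have fin: "finite V" "finite E" using hypergraph_finite[OF hyp] by auto
  define S where "S = {H\<in>E. y H \<noteq> 0}"
  define T where "T = {x\<in>V. load E y x = c}"
  have finST: "finite S" "finite T" using fin by (auto simp: S_def T_def)
  have "card S \<le> Suc (card T)"
  proof (rule ccontr)
    assume "\<not> card S \<le> Suc (card T)"
    then have "card (insert None (Some ` T)) < card S"
      using finST by (simp add: card_image)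
    with finST have "\<exists>z. (\<exists>H\<in>S. z H \<noteq> 0) \<and> (\<forall>t\<in>insert None (Some ` T).
         (\<Sum>H\<in>S. (case t of None \<Rightarrow> 1 | Some x \<Rightarrow> of_bool (x \<in> H)) * z H) = (0::real))"
      by (intro homogeneous_system_nontrivial) auto
    then obtain z :: "'a set \<Rightarrow> real" where z: "\<exists>H\<in>S. z H \<noteq> 0"
      "\<forall>t\<in>insert None (Some ` T).
         (\<Sum>H\<in>S. (case t of None \<Rightarrow> 1 | Some x \<Rightarrow> of_bool (x \<in> H)) * z H) = 0"
      by blast
    define w where "w = (\<lambda>H. if H \<in> S then z H else 0)"
    have SE: "S \<subseteq> E" by (auto simp: S_def)
    have "sum w E = 0"
      using z(2) SE fin(2) by (simp add: w_def sum.If_cases Int_absorb1)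
    moreover have "load E w x = 0" if "x \<in> T" for x
    proof -
      have "load E w x = (\<Sum>H\<in>{H\<in>E. x \<in> H} \<inter> S. z H)"
        unfolding load_def w_def using fin(2) by (simp add: sum.If_cases)
      also have "{H\<in>E. x \<in> H} \<inter> S = S \<inter> {H. x \<in> H}" using SE by auto
      also have "(\<Sum>H\<in>S \<inter> {H. x \<in> H}. z H) = (\<Sum>H\<in>S. if x \<in> H then z H else 0)"
        using finST by (simp add: sum.If_cases)
      also have "\<dots> = (\<Sum>H\<in>S. of_bool (x \<in> H) * z H)" by (intro sum.cong) auto
      finally show ?thesis using z(2) that by simp
    qed
    then have "slack E 0 w i = 0" if "i \<in> active V E c y" for i
      using that by (auto simp: active_def w_def S_def T_def)
    ultimately have "\<forall>H\<in>E. w H = 0" using det by (simp add: determined_def)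
    then show False using z(1) SE unfolding w_def by (metis subsetD)
  qed
  moreover have "real (card T) * c \<le> cost E y"
  proof -
    have "real (card T) * c = (\<Sum>x\<in>T. load E y x)" by (simp add: T_def)
    also have "\<dots> \<le> (\<Sum>x\<in>V. load E y x)"
      using fin load_nonneg[OF feas] by (intro sum_mono2) (auto simp: T_def)
    also have "\<dots> = cost E y" by (rule sum_load[OF hyp])
    finally show ?thesis .
  qed
  then have "real (card T) \<le> cost E y / c" using \<open>0 < c\<close> by (simp add: field_simps)
  ultimately show ?thesis unfolding S_def by linarith
qed

text \<open>
  The pairs \<open>(c, y)\<close> that satisfy the equations form an affine space in which \<open>c\<close> determines \<open>y\<close> on \<open>E\<close>:
  a line, a point or the empty set. Two solutions with different capacities give the
  slope \<open>w\<close>; if there is only one capacity, a constant function will do.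
\<close>
lemma determined_affine:
  assumes det: "determined E J"
  obtains u w where "\<And>c y H. sum y E = 1 \<Longrightarrow> (\<And>i. i \<in> J \<Longrightarrow> slack E c y i = 0) \<Longrightarrow> H \<in> E
    \<Longrightarrow> y H = u H + c * w H"
proof -
  define sol where "sol c y \<longleftrightarrow> sum y E = 1 \<and> (\<forall>i\<in>J. slack E c y i = 0)" for c y
  have uniq: "y1 H = y2 H + (c1 - c2) * w H"
    if "sol c1 y1" "sol c2 y2" "H \<in> E" "c1 \<noteq> c2 \<Longrightarrow> sum w E = 0 \<and> (\<forall>i\<in>J. slack E 1 w i = 0)"
    for c1 c2 y1 y2 w H
  proof -
    define v where "v = (\<lambda>H. y2 H + (c1 - c2) * w H)"
    define z where "z = (\<lambda>H. y1 H + (-1) * v H)"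
    have "slack E 0 z i = 0" if "i \<in> J" for i
    proof -
      have "slack E c1 v i = slack E c2 y2 i + (c1 - c2) * slack E 1 w i"
        using slack_affine[of E c2 "c1 - c2" 1 y2 w i] by (simp add: v_def)
      then have "slack E c1 v i = 0"
        using that \<open>sol c2 y2\<close> that(1) \<open>c1 \<noteq> c2 \<Longrightarrow> _\<close> by (auto simp: sol_def)
      moreover have "slack E 0 z i = slack E c1 y1 i + (-1) * slack E c1 v i"
        using slack_affine[of E c1 "-1" c1 y1 v i] by (simp add: z_def)
      ultimately show ?thesis using \<open>sol c1 y1\<close> that by (simp add: sol_def)
    qed
    moreover have "sum z E = 0"
      using that by (cases "c1 = c2")
        (auto simp: z_def v_def sol_def sum.distrib sum_subtractf sum_negf simp flip: sum_distrib_left)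
    ultimately have "z H = 0" using det \<open>H \<in> E\<close> unfolding determined_def by blast
    then show ?thesis by (simp add: z_def v_def)
  qed
  show thesis
  proof (cases "\<exists>c1 y1 c2 y2. sol c1 y1 \<and> sol c2 y2 \<and> c1 \<noteq> c2")
    case True
    then obtain c1 y1 c2 y2 where s: "sol c1 y1" "sol c2 y2" "c1 \<noteq> c2" by blast
    define w where "w = (\<lambda>H. (y1 H - y2 H) / (c1 - c2))"
    have w: "sum w E = 0" "\<forall>i\<in>J. slack E 1 w i = 0"
    proof -
      show "sum w E = 0"
        using s by (simp add: w_def sol_def sum_subtractf flip: sum_divide_distrib)
      have "y1 = (\<lambda>H. y2 H + (c1 - c2) * w H)" using s(3) by (simp add: w_def)
      then have "slack E c1 y1 i = slack E c2 y2 i + (c1 - c2) * slack E 1 w i" for i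
        using slack_affine[of E c2 "c1 - c2" 1 y2 w i] by simp
      then show "\<forall>i\<in>J. slack E 1 w i = 0" using s by (auto simp: sol_def)
    qed
    show thesis
    proof (rule that[of "\<lambda>H. y2 H - c2 * w H" w])
      fix c y H assume "sum y E = 1" "\<And>i. i \<in> J \<Longrightarrow> slack E c y i = 0" "H \<in> E"
      then have "y H = y2 H + (c - c2) * w H"
        using s(2) w by (intro uniq) (auto simp: sol_def)
      then show "y H = y2 H - c2 * w H + c * w H" by (simp add: algebra_simps)
    qed
  next
    case False
    show thesis
    proof (cases "\<exists>c0 y0. sol c0 y0")
      case True
      then obtain c0 y0 where s0: "sol c0 y0" by blast
      show thesis
      proof (rule that[of y0 "\<lambda>_. 0"])
        fix c y H assume "sum y E = 1" "\<And>i. i \<in> J \<Longrightarrow> slack E c y i = 0" "H \<in> E"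
        then have "sol c y" by (simp add: sol_def)
        with False s0 have "c = c0" by blast
        then show "y H = y0 H + c * 0"
          using uniq[OF \<open>sol c y\<close> s0 \<open>H \<in> E\<close>, of "\<lambda>_. 0"] by simp
      qed
    next
      case False
      then show thesis using that[of "\<lambda>_. 0" "\<lambda>_. 0"] by (auto simp: sol_def)
    qed
  qed
qed

text \<open>
  There are only finitely many sets of active constraints; each one that determines the weighting
  contributes one affine function.
\<close>
lemma finitely_many_affine_weightings:
  fixes V :: "'a set"
  assumes "finite V" "finite E"
  obtains G :: "(('a set \<Rightarrow> real) \<times> ('a set \<Rightarrow> real)) set" where "finite G"
    "\<And>c y. feasible_weighting V E c y \<Longrightarrow> \<exists>(u, w)\<in>G.
       feasible_weighting V E c (\<lambda>H. u H + c * w H) \<and> cost E (\<lambda>H. u H + c * w H) \<le> cost E y"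
proof -
  have "\<exists>g. determined E J \<longrightarrow> (\<forall>c y. sum y E = 1 \<longrightarrow> (\<forall>i\<in>J. slack E c y i = 0)
       \<longrightarrow> (\<forall>H\<in>E. y H = fst g H + c * snd g H))" for J
  proof (cases "determined E J")
    case True
    from determined_affine[OF this] obtain u w
      where "\<And>c y H. sum y E = 1 \<Longrightarrow> (\<And>i. i \<in> J \<Longrightarrow> slack E c y i = 0) \<Longrightarrow> H \<in> E
        \<Longrightarrow> y H = u H + c * w H" by blast
    then show ?thesis by (intro exI[of _ "(u, w)"]) auto
  qed simp
  then obtain g where g: "\<And>J c y H. determined E J \<Longrightarrow> sum y E = 1 \<Longrightarrow>
      (\<forall>i\<in>J. slack E c y i = 0) \<Longrightarrow> H \<in> E \<Longrightarrow> y H = fst (g J) H + c * snd (g J) H" by metis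
  show thesis
  proof (rule that[of "g ` Pow (E <+> V)"])
    show "finite (g ` Pow (E <+> V))" using assms by simp
    fix c y assume "feasible_weighting V E c y"
    from basic_weighting_exists[OF assms this] obtain y'
      where y': "feasible_weighting V E c y'" "cost E y' \<le> cost E y"
        "determined E (active V E c y')" by blast
    let ?J = "active V E c y'"
    have eq: "y' H = fst (g ?J) H + c * snd (g ?J) H" if "H \<in> E" for H
      using g[OF y'(3) _ _ that, of y' c] y'(1) by (auto simp: feasible_iff_slack active_def)
    have cong: "feasible_weighting V E c y' \<longleftrightarrow>
        feasible_weighting V E c (\<lambda>H. fst (g ?J) H + c * snd (g ?J) H)"
      "cost E y' = cost E (\<lambda>H. fst (g ?J) H + c * snd (g ?J) H)"
      using eq by (auto intro!: feasible_cong cost_cong)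
    have "?J \<in> Pow (E <+> V)" by (auto simp: active_def)
    then show "\<exists>(u, w)\<in>g ` Pow (E <+> V).
       feasible_weighting V E c (\<lambda>H. u H + c * w H) \<and> cost E (\<lambda>H. u H + c * w H) \<le> cost E y"
      using y'(1,2) cong
      by (intro bexI[of _ "g ?J"]) (auto simp: case_prod_beta)
  qed
qed

section \<open>Feasible capacities\<close>

lemma feasible_affine_closed:
  assumes "finite V" "finite E"
  shows "closed {c. feasible_weighting V E c (\<lambda>H. u H + c * w H)}"
proof -
  have "slack E c (\<lambda>H. u H + c * w H) i = slack E 0 u i + c * slack E 1 w i" for c i
    using slack_affine[of E 0 c 1 u w i] by simp
  then have "{c. feasible_weighting V E c (\<lambda>H. u H + c * w H)} =
      {c. sum u E + c * sum w E = 1} \<inter> (\<Inter>i\<in>E <+> V. {c. 0 \<le> slack E 0 u i + c * slack E 1 w i})"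
    by (auto simp: feasible_iff_slack sum.distrib sum_distrib_left)
  also have "closed \<dots>"
    by (intro closed_Int closed_INT ballI closed_Collect_eq closed_Collect_le continuous_intros)
  finally show ?thesis .
qed

lemma feasible_convex_combination:
  assumes "feasible_weighting V E c y" "feasible_weighting V E c' y'" "0 \<le> t" "t \<le> 1"
  shows "feasible_weighting V E (c + t * (c' - c)) (\<lambda>H. y H + t * (y' H - y H))"
proof -
  have "slack E (c + t * (c' - c)) (\<lambda>H. y H + t * (y' H - y H)) i
      = (1 - t) * slack E c y i + t * slack E c' y' i" for i
  proof -
    have "slack E (c' - c) (\<lambda>H. y' H - y H) i = slack E c' y' i - slack E c y i"
      using slack_affine[of E c' "-1" c y' y i] by simp
    then show ?thesis unfolding slack_affine by (simp only:) (simp add: algebra_simps)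
  qed
  moreover have "(\<Sum>H\<in>E. y H + t * (y' H - y H)) = 1"
    using assms(1,2)
    by (simp add: feasible_iff_slack sum.distrib sum_subtractf flip: sum_distrib_left)
  ultimately show ?thesis using assms by (simp add: feasible_iff_slack)
qed

lemma feasible_affine_convex:
  "convex {c. feasible_weighting V E c (\<lambda>H. u H + c * w H)}"
proof (rule convexI)
  fix c c' \<alpha> \<beta> :: real
  assume c: "c \<in> {c. feasible_weighting V E c (\<lambda>H. u H + c * w H)}"
    "c' \<in> {c. feasible_weighting V E c (\<lambda>H. u H + c * w H)}"
    and ab: "0 \<le> \<alpha>" "0 \<le> \<beta>" "\<alpha> + \<beta> = 1"
  have \<alpha>: "\<alpha> = 1 - \<beta>" using ab by simp
  have "feasible_weighting V E (c + \<beta> * (c' - c))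
      (\<lambda>H. (u H + c * w H) + \<beta> * ((u H + c' * w H) - (u H + c * w H)))"
    using c ab by (intro feasible_convex_combination) auto
  moreover have "c + \<beta> * (c' - c) = \<alpha> *\<^sub>R c + \<beta> *\<^sub>R c'" by (simp add: \<alpha> algebra_simps)
  moreover have "(u H + c * w H) + \<beta> * ((u H + c' * w H) - (u H + c * w H))
      = u H + (c + \<beta> * (c' - c)) * w H" for H by (simp add: algebra_simps)
  ultimately show "\<alpha> *\<^sub>R c + \<beta> *\<^sub>R c' \<in> {c. feasible_weighting V E c (\<lambda>H. u H + c * w H)}"
    by (simp only: mem_Collect_eq)
qed

text \<open>
  By \<open>finitely_many_affine_weightings\<close> the set is a finite union of closed sets, one for each of
  the affine weightings.
\<close>
lemma feasible_capacities_closed: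
  assumes "finite V" "finite E"
  shows "closed {c. \<exists>y. feasible_weighting V E c y}"
proof -
  obtain G where G: "finite G"
    "\<And>c y. feasible_weighting V E c y \<Longrightarrow> \<exists>(u, w)\<in>G.
       feasible_weighting V E c (\<lambda>H. u H + c * w H) \<and> cost E (\<lambda>H. u H + c * w H) \<le> cost E y"
    using finitely_many_affine_weightings[OF assms] by blast
  have "{c. \<exists>y. feasible_weighting V E c y} =
      (\<Union>(u, w)\<in>G. {c. feasible_weighting V E c (\<lambda>H. u H + c * w H)})"
    using G(2) by fast
  also have "closed \<dots>"
    using G(1) feasible_affine_closed[OF assms] by (intro closed_UN) auto
  finally show ?thesis .
qed

lemma matching_bounds:
  assumes "hypergraph V E"
  shows "bdd_above ((\<lambda>f. sum f E) ` {f. fractional_matching V E f})"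
    and "1 \<le> fractional_matching_number V E"
proof -
  have fin: "finite V" "finite E" using hypergraph_finite[OF assms] by auto
  show bdd: "bdd_above ((\<lambda>f. sum f E) ` {f. fractional_matching V E f})"
  proof (intro bdd_aboveI2)
    fix f assume "f \<in> {f. fractional_matching V E f}"
    then have f: "\<And>H. H \<in> E \<Longrightarrow> 0 \<le> f H" "\<And>x. x \<in> V \<Longrightarrow> (\<Sum>H\<in>{H\<in>E. x \<in> H}. f H) \<le> 1"
      by (auto simp: fractional_matching_def)
    have "f H \<le> 1" if "H \<in> E" for H
    proof -
      obtain x where x: "x \<in> H" "x \<in> V" using assms \<open>H \<in> E\<close> by (auto simp: hypergraph_def)
      have "f H \<le> (\<Sum>H\<in>{H\<in>E. x \<in> H}. f H)"
        using fin x that f(1) by (intro member_le_sum) auto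
      also have "\<dots> \<le> 1" using f(2) x by simp
      finally show ?thesis .
    qed
    then show "sum f E \<le> real (card E)" using sum_bounded_above[of E f 1] by simp
  qed
  obtain H where "H \<in> E" using assms by (auto simp: hypergraph_def)
  define f where "f = (\<lambda>H'. if H' = H then 1 else 0 :: real)"
  have "fractional_matching V E f"
    using fin by (auto simp: fractional_matching_def f_def sum.If_cases card_le_Suc0_iff_eq)
  then have "sum f E \<le> fractional_matching_number V E"
    unfolding fractional_matching_number_def by (intro cSUP_upper bdd) simp
  moreover have "sum f E = 1" using \<open>H \<in> E\<close> fin by (simp add: f_def)
  ultimately show "1 \<le> fractional_matching_number V E" by simp
qed

text \<open>
  Scaling turns a feasible weighting for \<open>c\<close> into a fractional matching of size \<open>1 / c\<close> and conversely.
  The supremum defining the matching number is only approached by matchings, so this yields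
  feasibility for all capacities above \<open>c\<close>, and closedness covers \<open>c\<close> itself.
\<close>
lemma feasible_iff_matching_number:
  assumes hyp: "hypergraph V E" and "0 < c"
  shows "1 / fractional_matching_number V E \<le> c \<longleftrightarrow> (\<exists>y. feasible_weighting V E c y)"
proof
  have fin: "finite V" "finite E" using hypergraph_finite[OF hyp] by auto
  let ?\<nu> = "fractional_matching_number V E"
  note \<nu> = matching_bounds[OF hyp]
  {
    assume "\<exists>y. feasible_weighting V E c y"
    then obtain y where y: "feasible_weighting V E c y" by blast
    have "fractional_matching V E (\<lambda>H. y H / c)"
      using y \<open>0 < c\<close> by (auto simp: fractional_matching_def feasible_weighting_def
          simp flip: sum_divide_distrib)
    then have "(\<Sum>H\<in>E. y H / c) \<le> ?\<nu>"
      unfolding fractional_matching_number_def by (intro cSUP_upper \<nu>(1)) simp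
    then have "1 / c \<le> ?\<nu>"
      using y by (simp add: feasible_weighting_def flip: sum_divide_distrib)
    then show "1 / ?\<nu> \<le> c" using \<open>0 < c\<close> \<nu>(2) by (simp add: field_simps)
  }
  assume c: "1 / ?\<nu> \<le> c"
  have "c' \<in> {c. \<exists>y. feasible_weighting V E c y}" if "c < c'" for c'
  proof -
    have c': "1 / c' < ?\<nu>" "0 < c'"
      using c that \<open>0 < c\<close> \<nu>(2) by (auto simp: field_simps intro: le_less_trans)
    have "{f. fractional_matching V E f} \<noteq> {}"
      by (auto simp: fractional_matching_def intro!: exI[of _ "\<lambda>_. 0"])
    then obtain f where f: "fractional_matching V E f" "1 / c' < sum f E"
      using c'(1) \<nu>(1) by (auto simp: fractional_matching_number_def less_cSUP_iff)
    have pos: "0 < sum f E" using f(2) c'(2) by (meson divide_pos_pos less_trans zero_less_one)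
    have "feasible_weighting V E (1 / sum f E) (\<lambda>H. f H / sum f E)"
      using f(1) pos by (auto simp: fractional_matching_def feasible_weighting_def divide_right_mono
          simp flip: sum_divide_distrib)
    moreover have "1 / sum f E \<le> c'" using f(2) c'(2) pos by (simp add: field_simps)
    ultimately show ?thesis using feasible_mono by blast
  qed
  then have "{c<..} \<subseteq> {c. \<exists>y. feasible_weighting V E c y}" by blast
  then have "closure {c<..} \<subseteq> {c. \<exists>y. feasible_weighting V E c y}"
    by (rule closure_minimal[OF _ feasible_capacities_closed[OF fin]])
  then show "\<exists>y. feasible_weighting V E c y" by auto
qed

text \<open>
  Suppose that \<open>c\<close> is irrational and let the additive map \<open>\<phi>\<close> fix \<open>1\<close> but not \<open>c\<close>. The pairs
  \<open>(c, y)\<close> and \<open>(\<phi> c, \<phi> \<circ> y)\<close> both have total weight \<open>1\<close>, and a slack that vanishes for the first also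
  vanishes for the second. So the line through them keeps the active constraints active, and a
  short move on it, in the direction of smaller capacity, leads to a feasible weighting.
\<close>
lemma minimal_capacity_rational:
  assumes "finite V" "finite E" and y: "feasible_weighting V E c y"
    and min: "\<And>c' y'. c' < c \<Longrightarrow> \<not> feasible_weighting V E c' y'"
  shows "c \<in> \<rat>"
proof (rule ccontr)
  assume "c \<notin> \<rat>"
  then obtain \<phi> where \<phi>: "Modules.additive \<phi>" "\<phi> 1 = 1" "\<phi> c \<noteq> c"
    by (rule additive_function_moving_irrational)
  interpret additive \<phi> by (rule \<phi>(1))
  have \<phi>_slack: "slack E (\<phi> c) (\<lambda>H. \<phi> (y H)) i = \<phi> (slack E c y i)" for i
    by (cases i) (simp_all add: load_def diff sum)
  \<comment> \<open>The sign makes the direction one of decreasing capacity.\<close>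
  define \<sigma> :: real where "\<sigma> = (if \<phi> c < c then 1 else - 1)"
  define d where "d = \<sigma> * (\<phi> c - c)"
  define z where "z = (\<lambda>H. \<sigma> * (\<phi> (y H) - y H))"
  have "d < 0" using \<phi>(3) by (auto simp: d_def \<sigma>_def)
  have dz: "slack E d z i = \<sigma> * (\<phi> (slack E c y i) - slack E c y i)" for i
    unfolding \<phi>_slack[symmetric]
    by (cases i) (simp_all add: d_def z_def load_def algebra_simps sum_distrib_left sum_subtractf)
  have sz: "sum z E = 0"
    using y \<phi>(2) by (simp add: z_def feasible_iff_slack sum_subtractf flip: sum_distrib_left sum)
  obtain t where t: "0 < t" "\<And>i. i \<in> E <+> V \<Longrightarrow> 0 \<le> slack E c y i + t * slack E d z i"
  proof (cases "\<exists>j\<in>E <+> V. slack E d z j < 0")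
    case True
    then obtain j where j: "j \<in> E <+> V" "slack E d z j < 0" by blast
    show thesis
    proof (rule ratio_test[of "E <+> V" "slack E c y" "slack E d z" j])
      show "slack E d z i = 0" if "slack E c y i = 0" for i using that by (simp add: dz zero)
    qed (use j y that assms(1,2) in \<open>auto simp: feasible_iff_slack simp del: slack_simps\<close>)
  next
    case False
    then show thesis using y that[of 1] by (force simp: feasible_iff_slack not_less simp del: slack_simps)
  qed
  have "feasible_weighting V E (c + t * d) (\<lambda>H. y H + t * z H)"
    using t(2) y sz unfolding feasible_iff_slack slack_affine
    by (simp add: sum.distrib flip: sum_distrib_left)
  moreover have "c + t * d < c" using t(1) \<open>d < 0\<close> by (simp add: mult_pos_neg)
  ultimately show False using min by blast
qed

section \<open>Small vertex sets\<close>

text \<open>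
  Edges form a set, so members of a family that coincide have to be merged; their weights add up.
\<close>
lemma weighting_of_family:
  fixes F :: "'i \<Rightarrow> 'a set"
  assumes "finite I" and p: "\<And>i. i \<in> I \<Longrightarrow> 0 \<le> p i" "sum p I = 1"
    and cap: "\<And>x. x \<in> V \<Longrightarrow> (\<Sum>i\<in>{i\<in>I. x \<in> F i}. p i) \<le> c"
  obtains y where "feasible_weighting V (F ` I) c y"
    "cost (F ` I) y = (\<Sum>i\<in>I. real (card (F i)) * p i)"
proof -
  define y where "y = (\<lambda>H. \<Sum>i\<in>{i\<in>I. F i = H}. p i)"
  have "sum y (F ` I) = sum p I"
    unfolding y_def by (rule sum.image_gen[symmetric, OF assms(1)])
  moreover have "(\<Sum>H\<in>{H\<in>F ` I. x \<in> H}. y H) = (\<Sum>i\<in>{i\<in>I. x \<in> F i}. p i)" for x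
  proof -
    have "{H\<in>F ` I. x \<in> H} = F ` {i\<in>I. x \<in> F i}" by auto
    moreover have "{i\<in>I. F i = H} = {i\<in>{i\<in>I. x \<in> F i}. F i = H}"
      if "H \<in> F ` {i\<in>I. x \<in> F i}" for H using that by auto
    ultimately show ?thesis
      unfolding y_def using assms(1)
      by (subst sum.image_gen[of "{i\<in>I. x \<in> F i}" p F]) (auto intro!: sum.cong)
  qed
  moreover have "cost (F ` I) y = (\<Sum>i\<in>I. real (card (F i)) * p i)"
    unfolding cost_def y_def
    by (subst sum.image_gen[of I _ F]) (auto simp: assms(1) sum_distrib_left intro!: sum.cong)
  moreover have "0 \<le> y H" for H unfolding y_def using p(1) by (auto intro!: sum_nonneg)
  ultimately show thesis using that[of y] p(2) cap by (auto simp: feasible_weighting_def)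
qed

lemma trace_on_small_set:
  assumes "finite S" and S: "\<And>H. H \<in> S \<Longrightarrow> H \<noteq> {} \<and> finite H" and "intersecting k S"
  obtains W where "W \<subseteq> \<Union> S" "finite W" "card W \<le> card S * (card S * k) + card S"
    "\<And>H. H \<in> S \<Longrightarrow> H \<inter> W \<noteq> {}"
    "\<And>H H'. H \<in> S \<Longrightarrow> H' \<in> S \<Longrightarrow> H \<noteq> H' \<Longrightarrow> k \<le> card (H \<inter> H' \<inter> W)"
proof -
  have "\<exists>P. P \<subseteq> H \<inter> H' \<and> finite P \<and> card P \<le> k \<and> (H \<noteq> H' \<longrightarrow> card P = k)"
    if HH: "H \<in> S" "H' \<in> S" for H H'
  proof (cases "H = H'")
    case False
    then have "k \<le> card (H \<inter> H')" using assms(3) HH by (simp add: intersecting_def)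
    then obtain P where "P \<subseteq> H \<inter> H'" "card P = k" "finite P"
      by (rule obtain_subset_with_card_n)
    then show ?thesis by blast
  qed (auto intro: exI[of _ "{}"])
  then obtain P where P: "\<And>H H'. H \<in> S \<Longrightarrow> H' \<in> S \<Longrightarrow> P H H' \<subseteq> H \<inter> H' \<and> finite (P H H')
      \<and> card (P H H') \<le> k \<and> (H \<noteq> H' \<longrightarrow> card (P H H') = k)" by metis
  obtain v where v: "\<And>H. H \<in> S \<Longrightarrow> v H \<in> H" using S by (metis equals0I)
  define W where "W = (\<Union>H\<in>S. \<Union>H'\<in>S. P H H') \<union> v ` S"
  have "card (\<Union>H\<in>S. \<Union>H'\<in>S. P H H') \<le> card S * (card S * k)"
  proof -
    have "card (\<Union>H'\<in>S. P H H') \<le> card S * k" if "H \<in> S" for H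
    proof -
      have "card (\<Union>H'\<in>S. P H H') \<le> (\<Sum>H'\<in>S. card (P H H'))" by (rule card_UN_le[OF assms(1)])
      also have "\<dots> \<le> card S * k" using sum_bounded_above[of S "\<lambda>H'. card (P H H')" k] P that by simp
      finally show ?thesis .
    qed
    then have "(\<Sum>H\<in>S. card (\<Union>H'\<in>S. P H H')) \<le> card S * (card S * k)"
      using sum_bounded_above[of S "\<lambda>H. card (\<Union>H'\<in>S. P H H')" "card S * k"] by simp
    then show ?thesis using card_UN_le[OF assms(1), of "\<lambda>H. \<Union>H'\<in>S. P H H'"] by linarith
  qed
  then have cW: "card W \<le> card S * (card S * k) + card S"
    unfolding W_def using card_image_le[OF assms(1), of v]
    by (intro order_trans[OF card_Un_le]) simp
  have fW: "finite W" unfolding W_def using assms(1) P by auto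
  show thesis
  proof (rule that[OF _ fW cW])
    show "W \<subseteq> \<Union> S" unfolding W_def using P v by blast
    show "H \<inter> W \<noteq> {}" if "H \<in> S" for H using that v unfolding W_def by blast
    fix H H' assume H: "H \<in> S" "H' \<in> S" "H \<noteq> H'"
    have "P H H' \<subseteq> H \<inter> H' \<inter> W" using P H by (auto simp: W_def)
    then have "card (P H H') \<le> card (H \<inter> H' \<inter> W)" using fW by (intro card_mono) auto
    then show "k \<le> card (H \<inter> H' \<inter> W)" using P H by simp
  qed
qed

text \<open>
  A basic weighting has at most \<open>N\<close> edges in its support. Replacing these edges by their traces on
  the set \<open>W\<close> of \<open>trace_on_small_set\<close> shrinks them, and the load of each vertex of \<open>W\<close> stays the
  same.
\<close>
lemma bounded_vertex_set:
  fixes V :: "'a set"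
  assumes hyp: "hypergraph V E" and int: "intersecting k E"
    and feas: "feasible_weighting V E c y" and c: "0 < c"
    and N: "1 + cost E y / c \<le> real N"
  obtains E' :: "nat set set" and y' where "hypergraph {..<N * (N * k) + N} E'" "intersecting k E'"
    "feasible_weighting {..<N * (N * k) + N} E' c y'" "cost E' y' \<le> cost E y"
proof -
  have fin: "finite V" "finite E" using hypergraph_finite[OF hyp] by auto
  obtain b where b: "feasible_weighting V E c b" "cost E b \<le> cost E y"
    "determined E (active V E c b)"
    using basic_weighting_exists[OF fin feas] by blast
  define S where "S = {H\<in>E. b H \<noteq> 0}"
  have S: "S \<subseteq> E" "finite S" using fin by (auto simp: S_def)
  have sumS: "(\<Sum>H\<in>{H\<in>S. Q H}. f H * b H) = (\<Sum>H\<in>{H\<in>E. Q H}. f H * b H)" for Q f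
    using fin by (intro sum.mono_neutral_left) (auto simp: S_def)
  have "card S \<le> N"
  proof -
    have "cost E b / c \<le> cost E y / c" using b(2) c by (simp add: divide_right_mono)
    then have "real (card S) \<le> real N"
      using basic_weighting_support[OF hyp b(1) c b(3)] N unfolding S_def by linarith
    then show ?thesis by simp
  qed
  have edge: "H \<noteq> {} \<and> finite H" if "H \<in> S" for H
    using that hyp S fin by (auto simp: hypergraph_def intro: finite_subset)
  have "intersecting k S" using int S by (auto simp: intersecting_def)
  from trace_on_small_set[OF S(2) edge this] obtain W
    where W: "W \<subseteq> \<Union> S" "finite W" "card W \<le> card S * (card S * k) + card S"
      "\<And>H. H \<in> S \<Longrightarrow> H \<inter> W \<noteq> {}"
      "\<And>H H'. H \<in> S \<Longrightarrow> H' \<in> S \<Longrightarrow> H \<noteq> H' \<Longrightarrow> k \<le> card (H \<inter> H' \<inter> W)" by blast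
  obtain g where "bij_betw g W {0..<card W}" using W(2) ex_bij_betw_finite_nat by blast
  then have g: "inj_on g W" "g ` W = {..<card W}" by (auto simp: bij_betw_def atLeast0LessThan)
  let ?K = "N * (N * k) + N"
  have "card S * (card S * k) + card S \<le> ?K"
    using \<open>card S \<le> N\<close> by (intro add_mono mult_mono) auto
  with W(3) have K: "card W \<le> ?K" by simp
  define F where "F H = g ` (H \<inter> W)" for H
  have cF: "card (F H) = card (H \<inter> W)" for H
    unfolding F_def using g(1) by (intro card_image) (auto intro: inj_on_subset)
  have capF: "(\<Sum>H\<in>{H\<in>S. x \<in> F H}. b H) \<le> c" for x
  proof (cases "x \<in> g ` W")
    case True
    then obtain a where a: "a \<in> W" "x = g a" by blast
    have "{H\<in>S. x \<in> F H} = {H\<in>S. a \<in> H}"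
      using a g(1) by (auto simp: F_def inj_on_def)
    moreover have "a \<in> V" using a W(1) S hyp by (auto simp: hypergraph_def)
    ultimately show ?thesis
      using b(1) sumS[of "\<lambda>_. 1" "\<lambda>H. a \<in> H"] by (simp add: feasible_weighting_def)
  next
    case False
    then have "{H\<in>S. x \<in> F H} = {}" by (auto simp: F_def)
    then show ?thesis using c by (simp only: sum.empty)
  qed
  have sum1: "sum b S = 1"
    using b(1) sumS[of "\<lambda>_. 1" "\<lambda>H. True"] by (simp add: feasible_weighting_def)
  obtain y' where y': "feasible_weighting {..<?K} (F ` S) c y'"
    "cost (F ` S) y' = (\<Sum>H\<in>S. real (card (F H)) * b H)"
  proof (rule weighting_of_family[OF S(2) _ sum1 capF, of "{..<?K}"])
    show "0 \<le> b H" if "H \<in> S" for H using b(1) S(1) that by (auto simp: feasible_weighting_def)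
  qed
  show thesis
  proof (rule that[OF _ _ y'(1)])
    have "S \<noteq> {}" using sum1 by auto
    moreover have "F H \<subseteq> {..<?K}" for H
    proof -
      have "F H \<subseteq> g ` W" unfolding F_def by blast
      then show ?thesis using g(2) K by auto
    qed
    ultimately show "hypergraph {..<?K} (F ` S)"
      using W(4) by (auto simp: hypergraph_def F_def)
    show "intersecting k (F ` S)"
      unfolding intersecting_def
    proof (clarify)
      fix H H' assume H: "H \<in> S" "H' \<in> S" "F H \<noteq> F H'"
      have "F H \<inter> F H' = g ` (H \<inter> H' \<inter> W)"
        using g(1) by (auto simp: F_def inj_on_def)
      moreover have "card (g ` (H \<inter> H' \<inter> W)) = card (H \<inter> H' \<inter> W)"
        using g(1) by (intro card_image) (auto intro: inj_on_subset)
      ultimately show "k \<le> card (F H \<inter> F H')" using W(5)[OF H(1,2)] H(3) by auto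
    qed
    have "cost (F ` S) y' \<le> (\<Sum>H\<in>S. real (card H) * b H)"
      unfolding y'(2) cF using b(1) S edge
      by (intro sum_mono mult_right_mono) (auto simp: feasible_weighting_def intro: card_mono)
    also have "\<dots> = cost E b" using sumS[of "\<lambda>H. real (card H)" "\<lambda>H. True"] by (simp add: cost_def)
    finally show "cost (F ` S) y' \<le> cost E y" using b(2) by simp
  qed
qed

text \<open>
  The edges are the \<open>n\<close> stars in a complete graph with loops on \<open>n\<close> points, every ordered pair of
  points being taken \<open>k\<close> times. Each vertex lies in at most two stars, so uniform weights have loads
  at most \<open>2 / n\<close>.
\<close>
lemma intersecting_hypergraph_of_small_capacity:
  fixes c :: real
  assumes "0 < c" "0 < k"
  obtains V :: "nat set" and E y where "hypergraph V E" "intersecting k E"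
    "feasible_weighting V E c y"
proof -
  obtain n :: nat where n: "2 / c < real n" using reals_Archimedean2 by blast
  then have n0: "0 < n" using assms(1) by (cases n) auto
  define F :: "nat \<Rightarrow> nat set"
    where "F i = to_nat ` {(a, b, l). (a = i \<or> b = i) \<and> a < n \<and> b < n \<and> l < k}" for i
  have fin: "finite (F i)" for i
  proof -
    have "{(a, b, l). (a = i \<or> b = i) \<and> a < n \<and> b < n \<and> l < k} \<subseteq> {..<n} \<times> {..<n} \<times> {..<k}" by auto
    then show ?thesis unfolding F_def by (rule finite_imageI[OF finite_subset]) simp
  qed
  have cap: "(\<Sum>i\<in>{i\<in>{..<n}. x \<in> F i}. 1 / real n) \<le> c" for x
  proof -
    have "\<exists>a b. {i\<in>{..<n}. x \<in> F i} \<subseteq> {a, b}"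
    proof (cases "\<exists>i. x \<in> F i")
      case True
      then obtain a b l :: nat where "x = to_nat (a, b, l)" by (auto simp: F_def)
      then show ?thesis by (intro exI[of _ a] exI[of _ b]) (auto simp: F_def)
    qed auto
    then obtain a b where "{i\<in>{..<n}. x \<in> F i} \<subseteq> {a, b}" by blast
    then have "card {i\<in>{..<n}. x \<in> F i} \<le> card {a, b}" by (intro card_mono) auto
    also have "\<dots> \<le> 2" by (simp add: card_insert_if)
    finally have "real (card {i\<in>{..<n}. x \<in> F i}) / real n \<le> 2 / real n"
      by (intro divide_right_mono) auto
    also have "\<dots> \<le> c" using n n0 assms(1) by (simp add: field_simps)
    finally show ?thesis by simp
  qed
  obtain y where y: "feasible_weighting (\<Union>i<n. F i) (F ` {..<n}) c y"
    using weighting_of_family[of "{..<n}" "\<lambda>_. 1 / real n" "\<Union>i<n. F i" F c] cap n0 by auto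
  show thesis
  proof (rule that[OF _ _ y])
    have "to_nat (i, i, 0::nat) \<in> F i" if "i < n" for i using that assms(2) by (auto simp: F_def)
    then show "hypergraph (\<Union>i<n. F i) (F ` {..<n})"
      using fin n0 by (auto simp: hypergraph_def)
    show "intersecting k (F ` {..<n})"
      unfolding intersecting_def
    proof clarify
      fix i j assume ij: "i < n" "j < n"
      have "(\<lambda>l. to_nat (i, j, l)) ` {..<k} \<subseteq> F i \<inter> F j" using ij by (auto simp: F_def)
      then have "card ((\<lambda>l. to_nat (i, j, l)) ` {..<k}) \<le> card (F i \<inter> F j)"
        using fin by (intro card_mono) auto
      moreover have "card ((\<lambda>l. to_nat (i, j, l)) ` {..<k}) = k"
        by (subst card_image) (auto simp: inj_on_def)
      ultimately show "k \<le> card (F i \<inter> F j)" by simp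
    qed
  qed
qed

section \<open>The function as a lower envelope of segments\<close>

text \<open>
  One hypergraph that is feasible for \<open>e\<close>, with cost \<open>M\<close>, serves as a competitor for all \<open>c \<ge> e\<close>.
  Weightings of larger cost may be replaced by it, and for the others \<open>bounded_vertex_set\<close>
  gives a vertex set of bounded size.
\<close>
lemma finitely_many_candidates:
  assumes "0 < e" "0 < k"
  obtains K and G :: "(nat set set \<times> (nat set \<Rightarrow> real) \<times> (nat set \<Rightarrow> real)) set"
  where "finite G" "\<And>E u w. (E, u, w) \<in> G \<Longrightarrow> hypergraph {..<K} E \<and> intersecting k E"
    "\<And>c (V :: nat set) E y. e \<le> c \<Longrightarrow> hypergraph V E \<Longrightarrow> intersecting k E \<Longrightarrow>
      feasible_weighting V E c y \<Longrightarrow> \<exists>(E', u, w)\<in>G.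
        feasible_weighting {..<K} E' c (\<lambda>H. u H + c * w H) \<and>
        cost E' (\<lambda>H. u H + c * w H) \<le> cost E y"
proof -
  obtain V0 :: "nat set" and E0 y0 where ex: "hypergraph V0 E0" "intersecting k E0"
    "feasible_weighting V0 E0 e y0"
    using intersecting_hypergraph_of_small_capacity[OF assms] by blast
  define M where "M = cost E0 y0"
  define N where "N = nat \<lceil>1 + M / e\<rceil>"
  define K where "K = N * (N * k) + N"
  define \<E> where "\<E> = {E. hypergraph {..<K} E \<and> intersecting k E}"
  have "\<E> \<subseteq> Pow (Pow {..<K})" by (auto simp: \<E>_def hypergraph_def)
  then have fin\<E>: "finite \<E>" by (rule finite_subset) simp
  define covers where "covers E G \<longleftrightarrow> finite G \<and>
     (\<forall>c y. feasible_weighting {..<K} E c y \<longrightarrow> (\<exists>(u, w)\<in>G.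
       feasible_weighting {..<K} E c (\<lambda>H. u H + c * w H) \<and>
       cost E (\<lambda>H. u H + c * w H) \<le> cost E y))"
    for E and G :: "((nat set \<Rightarrow> real) \<times> (nat set \<Rightarrow> real)) set"
  have "\<exists>G. covers E G" if "E \<in> \<E>" for E
  proof -
    have "finite E" using that hypergraph_finite by (auto simp: \<E>_def)
    then show ?thesis
    proof (rule finitely_many_affine_weightings[OF finite_lessThan])
      fix G :: "((nat set \<Rightarrow> real) \<times> (nat set \<Rightarrow> real)) set"
      assume "finite G" "\<And>c y. feasible_weighting {..<K} E c y \<Longrightarrow> \<exists>(u, w)\<in>G.
         feasible_weighting {..<K} E c (\<lambda>H. u H + c * w H) \<and>
         cost E (\<lambda>H. u H + c * w H) \<le> cost E y"
      then have "covers E G" by (simp add: covers_def)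
      then show ?thesis by (rule exI)
    qed
  qed
  then have "\<exists>\<Gamma>. \<forall>E\<in>\<E>. covers E (\<Gamma> E)" by (intro bchoice) blast
  then obtain \<Gamma> where "\<forall>E\<in>\<E>. covers E (\<Gamma> E)" by blast
  then have \<Gamma>: "\<And>E. E \<in> \<E> \<Longrightarrow> finite (\<Gamma> E)"
    "\<And>E c y. E \<in> \<E> \<Longrightarrow>
      feasible_weighting {..<K} E c y \<Longrightarrow> \<exists>(u, w)\<in>\<Gamma> E.
       feasible_weighting {..<K} E c (\<lambda>H. u H + c * w H) \<and>
       cost E (\<lambda>H. u H + c * w H) \<le> cost E y" unfolding covers_def by simp_all
  show thesis
  proof (rule that[of "Sigma \<E> \<Gamma>" K])
    show "finite (Sigma \<E> \<Gamma>)" using fin\<E> \<Gamma>(1) by simp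
    show "hypergraph {..<K} E \<and> intersecting k E" if "(E, u, w) \<in> Sigma \<E> \<Gamma>" for E u w
      using that by (simp add: \<E>_def)
    fix c and V :: "nat set" and E y
    assume c: "e \<le> c" and y: "hypergraph V E" "intersecting k E" "feasible_weighting V E c y"
    have small: "\<exists>E'\<in>\<E>. \<exists>y'. feasible_weighting {..<K} E' c y' \<and> cost E' y' \<le> cost E1 y1"
      if y1: "hypergraph V1 E1" "intersecting k E1" "feasible_weighting V1 E1 c y1" "cost E1 y1 \<le> M"
      for V1 :: "nat set" and E1 y1
    proof -
      have "cost E1 y1 / c \<le> M / e"
        using y1(4) cost_nonneg[OF y1(3)] c assms(1) by (intro frac_le) auto
      then have "1 + cost E1 y1 / c \<le> real N" unfolding N_def by linarith
      moreover have "0 < c" using c assms(1) by simp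
      ultimately obtain E' y' where "hypergraph {..<N * (N * k) + N} E'" "intersecting k E'"
        "feasible_weighting {..<N * (N * k) + N} E' c y'" "cost E' y' \<le> cost E1 y1"
        using bounded_vertex_set[OF y1(1-3)] by blast
      then show ?thesis unfolding \<E>_def K_def by blast
    qed
    have "\<exists>E'\<in>\<E>. \<exists>y'. feasible_weighting {..<K} E' c y' \<and> cost E' y' \<le> cost E y"
    proof (cases "cost E y \<le> M")
      case True
      then show ?thesis using small y by blast
    next
      case False
      then show ?thesis
        using small[OF ex(1,2) feasible_mono[OF ex(3) c]] by (force simp: M_def)
    qed
    then obtain E' y' where E': "E' \<in> \<E>" "feasible_weighting {..<K} E' c y'" "cost E' y' \<le> cost E y"
      by blast
    from \<Gamma>(2)[OF E'(1,2)] obtain u w where "(u, w) \<in> \<Gamma> E'"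
      "feasible_weighting {..<K} E' c (\<lambda>H. u H + c * w H)"
      "cost E' (\<lambda>H. u H + c * w H) \<le> cost E' y'" by auto
    with E' show "\<exists>(E', u, w)\<in>Sigma \<E> \<Gamma>. feasible_weighting {..<K} E' c (\<lambda>H. u H + c * w H) \<and>
        cost E' (\<lambda>H. u H + c * w H) \<le> cost E y" by (intro bexI[of _ "(E', u, w)"]) auto
  qed
qed

text \<open>
  In \<open>A_fun\<close> an infimum over hypergraphs encloses one over weightings. A minimal pair of hypergraph and
  weighting attains both; the condition on the matching number says that the inner infimum is over
  a nonempty set.
\<close>
lemma A_fun_eq_minimum:
  fixes V0 :: "nat set"
  assumes "0 < c" and ex: "hypergraph V0 E0" "intersecting k E0" "feasible_weighting V0 E0 c y0"
    and min: "\<And>(V :: nat set) E y. hypergraph V E \<Longrightarrow> intersecting k E \<Longrightarrow>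
      feasible_weighting V E c y \<Longrightarrow> cost E0 y0 \<le> cost E y"
  shows "A_fun k c = cost E0 y0"
  unfolding A_fun_def
proof (rule cInf_eq_minimum)
  have "a_value V0 E0 c = cost E0 y0"
    unfolding a_value_def cost_def[symmetric] using ex min by (intro cInf_eq_minimum) auto
  then show "cost E0 y0 \<in> {a_value V E c |(V :: nat set) E.
      hypergraph V E \<and> intersecting k E \<and> 1 / fractional_matching_number V E \<le> c}"
    using ex feasible_iff_matching_number[OF ex(1) assms(1)]
    by (intro CollectI exI[of _ V0] exI[of _ E0]) auto
  fix v assume "v \<in> {a_value V E c |(V :: nat set) E.
      hypergraph V E \<and> intersecting k E \<and> 1 / fractional_matching_number V E \<le> c}"
  then obtain V :: "nat set" and E where v: "v = a_value V E c" "hypergraph V E" "intersecting k E"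
    "1 / fractional_matching_number V E \<le> c" by blast
  have "{y. feasible_weighting V E c y} \<noteq> {}"
    using v feasible_iff_matching_number[OF v(2) assms(1)] by blast
  then show "cost E0 y0 \<le> v"
    unfolding v(1) a_value_def cost_def[symmetric] using min v(2,3) by (intro cINF_greatest) auto
qed

lemma A_fun_attained:
  assumes "0 < e" "0 < k"
  obtains K and G :: "(nat set set \<times> (nat set \<Rightarrow> real) \<times> (nat set \<Rightarrow> real)) set"
  where "finite G" "\<And>E u w. (E, u, w) \<in> G \<Longrightarrow> hypergraph {..<K} E \<and> intersecting k E"
    "\<And>c. e \<le> c \<Longrightarrow> \<exists>(E, u, w)\<in>G. feasible_weighting {..<K} E c (\<lambda>H. u H + c * w H) \<and>
       A_fun k c = cost E (\<lambda>H. u H + c * w H)"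
    "\<And>c (V :: nat set) E y. e \<le> c \<Longrightarrow> hypergraph V E \<Longrightarrow> intersecting k E \<Longrightarrow>
      feasible_weighting V E c y \<Longrightarrow> A_fun k c \<le> cost E y"
proof -
  obtain K and G :: "(nat set set \<times> (nat set \<Rightarrow> real) \<times> (nat set \<Rightarrow> real)) set"
    where G: "finite G" "\<And>E u w. (E, u, w) \<in> G \<Longrightarrow> hypergraph {..<K} E \<and> intersecting k E"
      "\<And>c (V :: nat set) E y. e \<le> c \<Longrightarrow> hypergraph V E \<Longrightarrow> intersecting k E \<Longrightarrow>
        feasible_weighting V E c y \<Longrightarrow> \<exists>(E', u, w)\<in>G.
          feasible_weighting {..<K} E' c (\<lambda>H. u H + c * w H) \<and>
          cost E' (\<lambda>H. u H + c * w H) \<le> cost E y"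
    by (rule finitely_many_candidates[OF assms]) blast
  obtain V0 :: "nat set" and E0 y0 where ex: "hypergraph V0 E0" "intersecting k E0"
    "feasible_weighting V0 E0 e y0"
    using intersecting_hypergraph_of_small_capacity[OF assms] by blast
  have key: "\<exists>(E, u, w)\<in>G. feasible_weighting {..<K} E c (\<lambda>H. u H + c * w H) \<and>
       A_fun k c = cost E (\<lambda>H. u H + c * w H) \<and>
      (\<forall>(V :: nat set) E y. hypergraph V E \<longrightarrow> intersecting k E \<longrightarrow>
        feasible_weighting V E c y \<longrightarrow> A_fun k c \<le> cost E y)" if c: "e \<le> c" for c
  proof -
    define val where "val = (\<lambda>(E, u, w). cost E (\<lambda>H :: nat set. u H + c * w H))"
    define Gc where "Gc = {(E, u, w)\<in>G. feasible_weighting {..<K} E c (\<lambda>H. u H + c * w H)}"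
    have "finite Gc" using G(1) by (auto simp: Gc_def intro: finite_subset)
    moreover have "Gc \<noteq> {}"
      using G(3)[OF c ex(1,2) feasible_mono[OF ex(3) c]] by (auto simp: Gc_def)
    ultimately obtain g where g: "g \<in> Gc" "\<And>h. h \<in> Gc \<Longrightarrow> val g \<le> val h"
      using arg_min_if_finite[of Gc val] by (meson not_le)
    obtain E1 u1 w1 where g1: "g = (E1, u1, w1)" by (cases g)
    have min: "val g \<le> cost E y" if VE: "hypergraph V E" "intersecting k E" "feasible_weighting V E c y"
      for V :: "nat set" and E y
    proof -
      obtain E' u w where "(E', u, w) \<in> Gc" "cost E' (\<lambda>H. u H + c * w H) \<le> cost E y"
        using G(3)[OF c VE] by (auto simp: Gc_def)
      then show ?thesis using g(2)[of "(E', u, w)"] by (simp add: val_def)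
    qed
    have f1: "(E1, u1, w1) \<in> G" "feasible_weighting {..<K} E1 c (\<lambda>H. u1 H + c * w1 H)"
      "val g = cost E1 (\<lambda>H. u1 H + c * w1 H)"
      using g(1) by (auto simp: g1 Gc_def val_def)
    have "A_fun k c = cost E1 (\<lambda>H. u1 H + c * w1 H)"
      using G(2)[OF f1(1)] f1 min c assms(1) by (intro A_fun_eq_minimum) auto
    then show ?thesis using f1 min by (intro bexI[of _ "(E1, u1, w1)"]) auto
  qed
  show thesis
  proof (rule that[OF G(1,2)])
    fix c assume "e \<le> c"
    from key[OF this] show "\<exists>(E, u, w)\<in>G. feasible_weighting {..<K} E c (\<lambda>H. u H + c * w H) \<and>
       A_fun k c = cost E (\<lambda>H. u H + c * w H)" by fast
  next
    fix c and V :: "nat set" and E y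
    assume "e \<le> c" "hypergraph V E" "intersecting k E" "feasible_weighting V E c y"
    then show "A_fun k c \<le> cost E y" using key[of c] by fast
  qed auto
qed

lemma A_fun_le_cost:
  fixes V :: "nat set"
  assumes "0 < c" "0 < k" "hypergraph V E" "intersecting k E" "feasible_weighting V E c y"
  shows "A_fun k c \<le> cost E y"
proof -
  have "\<forall>(V :: nat set) E y. hypergraph V E \<longrightarrow> intersecting k E \<longrightarrow>
      feasible_weighting V E c y \<longrightarrow> A_fun k c \<le> cost E y"
    by (rule A_fun_attained[OF assms(1,2)]) simp
  then show ?thesis using assms(3-5) by blast
qed

lemma A_fun_minimiser:
  assumes "0 < c" "0 < k"
  obtains V :: "nat set" and E y where "hypergraph V E" "intersecting k E"
    "feasible_weighting V E c y" "A_fun k c = cost E y"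
proof -
  obtain K and G :: "(nat set set \<times> (nat set \<Rightarrow> real) \<times> (nat set \<Rightarrow> real)) set"
    where G: "\<And>E u w. (E, u, w) \<in> G \<Longrightarrow> hypergraph {..<K} E \<and> intersecting k E"
    "\<And>c'. c \<le> c' \<Longrightarrow> \<exists>(E, u, w)\<in>G. feasible_weighting {..<K} E c' (\<lambda>H. u H + c' * w H) \<and>
       A_fun k c' = cost E (\<lambda>H. u H + c' * w H)"
    by (rule A_fun_attained[OF assms]) blast
  from G(2)[of c] obtain E u w where "(E, u, w) \<in> G"
    "feasible_weighting {..<K} E c (\<lambda>H. u H + c * w H)" "A_fun k c = cost E (\<lambda>H. u H + c * w H)"
    by auto
  then show thesis using that G(1) by blast
qed

lemma A_fun_antimono:
  assumes "0 < k"
  shows "antimono_on {0<..1} (A_fun k)"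
proof (rule monotone_onI)
  fix c c' :: real assume c: "c \<in> {0<..1}" "c' \<in> {0<..1}" "c \<le> c'"
  obtain V :: "nat set" and E y where y: "hypergraph V E" "intersecting k E"
    "feasible_weighting V E c y" "A_fun k c = cost E y"
    using A_fun_minimiser[of c k] c(1) assms by auto
  show "A_fun k c' \<le> A_fun k c"
    using A_fun_le_cost[of c' k V E y] y c assms feasible_mono[OF y(3) c(3)] by simp
qed

text \<open>
  A quadruple \<open>(p, q, a, b)\<close> is the segment of the line \<open>p * x + q\<close> over the closed interval
  \<open>{a..b}\<close>. No segment goes below \<open>f\<close>, and each point of the graph over \<open>X\<close> lies on some segment.
\<close>
definition segment_envelope :: "real set \<Rightarrow> (real \<Rightarrow> real) \<Rightarrow> bool" where
  "segment_envelope X f \<longleftrightarrow> (\<exists>G :: (real \<times> real \<times> real \<times> real) set. finite G \<and>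
     (\<forall>(p, q, a, b)\<in>G. \<forall>x\<in>{a..b}. f x \<le> p * x + q) \<and>
     (\<forall>x\<in>X. \<exists>(p, q, a, b)\<in>G. x \<in> {a..b} \<and> f x = p * x + q))"

lemma A_fun_envelope:
  assumes "0 < e" "0 < k"
  shows "segment_envelope {e..1} (A_fun k)"
proof -
  obtain K and G :: "(nat set set \<times> (nat set \<Rightarrow> real) \<times> (nat set \<Rightarrow> real)) set"
    where G: "finite G" "\<And>E u w. (E, u, w) \<in> G \<Longrightarrow> hypergraph {..<K} E \<and> intersecting k E"
    "\<And>c. e \<le> c \<Longrightarrow> \<exists>(E, u, w)\<in>G. feasible_weighting {..<K} E c (\<lambda>H. u H + c * w H) \<and>
       A_fun k c = cost E (\<lambda>H. u H + c * w H)"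
    by (rule A_fun_attained[OF assms]) blast
  define C where "C = (\<lambda>(E, u, w). {c. feasible_weighting {..<K} E c (\<lambda>H. u H + c * w H)} \<inter> {e..1})"
  have "\<exists>I. C g = {fst I..snd I}" if "g \<in> G" for g
  proof -
    obtain E u w where g: "g = (E, u, w)" by (cases g)
    have "finite E" using G(2) that g hypergraph_finite by blast
    then have "closed {c. feasible_weighting {..<K} E c (\<lambda>H. u H + c * w H)}"
      by (intro feasible_affine_closed) auto
    then have "compact (C g)" unfolding C_def g by (simp add: closed_Int_compact)
    moreover have "connected (C g)"
      unfolding C_def g by (auto intro!: convex_connected convex_Int feasible_affine_convex)
    ultimately have "\<exists>a b. C g = {a..b}" using connected_compact_interval_1[of "C g"] by simp
    then obtain a b where "C g = {a..b}" by blast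
    then show ?thesis by (intro exI[of _ "(a, b)"]) simp
  qed
  then have "\<exists>I. \<forall>g\<in>G. C g = {fst (I g)..snd (I g)}" by (intro bchoice) blast
  then obtain I where I: "\<And>g. g \<in> G \<Longrightarrow> C g = {fst (I g)..snd (I g)}" by blast
  define \<Phi> where "\<Phi> g = (case g of (E, u, w) \<Rightarrow> (cost E w, cost E u, fst (I g), snd (I g)))" for g
  show ?thesis
    unfolding segment_envelope_def
  proof (intro exI[of _ "\<Phi> ` G"] conjI ballI)
    show "finite (\<Phi> ` G)" using G(1) by simp
    fix s assume "s \<in> \<Phi> ` G"
    then obtain E u w where g: "(E, u, w) \<in> G" "s = \<Phi> (E, u, w)" by auto
    have "A_fun k x \<le> cost E w * x + cost E u" if "x \<in> C (E, u, w)" for x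
    proof -
      have "A_fun k x \<le> cost E (\<lambda>H. u H + x * w H)"
        using that G(2)[OF g(1)] assms by (intro A_fun_le_cost[of x k "{..<K}"]) (auto simp: C_def)
      then show ?thesis by (simp add: cost_affine algebra_simps)
    qed
    then show "case s of (p, q, a, b) \<Rightarrow> \<forall>x\<in>{a..b}. A_fun k x \<le> p * x + q"
      using I[OF g(1)] by (simp add: g(2) \<Phi>_def case_prod_beta)
  next
    fix x assume x: "x \<in> {e..1}"
    then obtain E u w where g: "(E, u, w) \<in> G"
      "feasible_weighting {..<K} E x (\<lambda>H. u H + x * w H)" "A_fun k x = cost E (\<lambda>H. u H + x * w H)"
      using G(3)[of x] by auto
    then have "x \<in> C (E, u, w)" using x by (simp add: C_def)
    then have "case \<Phi> (E, u, w) of (p, q, a, b) \<Rightarrow> x \<in> {a..b} \<and> A_fun k x = p * x + q"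
      using g(3) I[OF g(1)] by (simp add: \<Phi>_def case_prod_beta cost_affine algebra_simps)
    then show "\<exists>(p, q, a, b)\<in>\<Phi> ` G. x \<in> {a..b} \<and> A_fun k x = p * x + q"
      using imageI[OF g(1), of \<Phi>] by (rule bexI)
  qed
qed

section \<open>Breakpoints of lower envelopes\<close>

text \<open>
  The breakpoints are the ends of the segments and the crossings of their lines. On an interval
  that avoids them, a segment is present everywhere or nowhere and two lines keep their order, so
  the segment that attains the minimum at one point attains it everywhere.
\<close>
lemma envelope_breakpoints:
  assumes "segment_envelope X f"
  obtains B where "finite B"
    "\<And>a b. {a<..<b} \<subseteq> X - B \<Longrightarrow> \<exists>p q. \<forall>x\<in>{a<..<b}. f x = p * x + q"
proof -
  obtain G :: "(real \<times> real \<times> real \<times> real) set" where G: "finite G"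
    "\<And>p q s t x. (p, q, s, t) \<in> G \<Longrightarrow> x \<in> {s..t} \<Longrightarrow> f x \<le> p * x + q"
    "\<And>x. x \<in> X \<Longrightarrow> \<exists>(p, q, s, t)\<in>G. x \<in> {s..t} \<and> f x = p * x + q"
    using assms unfolding segment_envelope_def by fast
  define B where "B = (\<lambda>(p, q, s, t). s) ` G \<union> (\<lambda>(p, q, s, t). t) ` G
    \<union> (\<lambda>((p, q, s, t), (p', q', s', t')). (q' - q) / (p - p')) ` (G \<times> G)"
  show thesis
  proof (rule that[of B])
    show "finite B" using G(1) by (simp add: B_def)
    fix a b assume ab: "{a<..<b} \<subseteq> X - B"
    show "\<exists>p q. \<forall>x\<in>{a<..<b}. f x = p * x + q"
    proof (cases "{a<..<b} = {}")
      case False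
      then obtain x0 where x0: "x0 \<in> {a<..<b}" by blast
      have whole: "x \<in> {s..t}" if "(p, q, s, t) \<in> G" "x1 \<in> {a<..<b}" "x1 \<in> {s..t}" "x \<in> {a<..<b}"
        for p q s t x1 x
      proof -
        have "s \<in> B" "t \<in> B" using that(1) by (force simp: B_def)+
        then have "s \<notin> {a<..<b}" "t \<notin> {a<..<b}" using ab by auto
        then show ?thesis using that(2-4) by auto
      qed
      obtain p q s t where g: "(p, q, s, t) \<in> G" "x0 \<in> {s..t}" "f x0 = p * x0 + q"
        using G(3)[of x0] subsetD[OF ab x0] by auto
      have "f x = p * x + q" if x: "x \<in> {a<..<b}" for x
      proof (rule antisym)
        show "f x \<le> p * x + q" using G(2)[OF g(1)] whole[OF g(1) x0 g(2) x] by blast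
        obtain p' q' s' t' where h: "(p', q', s', t') \<in> G" "x \<in> {s'..t'}" "f x = p' * x + q'"
          using G(3)[of x] subsetD[OF ab x] by auto
        have le0: "p * x0 + q \<le> p' * x0 + q'"
          using G(2)[OF h(1)] whole[OF h(1) x h(2) x0] g(3) by fastforce
        have "p * x + q \<le> p' * x + q'"
        proof (cases "p = p'")
          case False
          define r where "r = (q' - q) / (p - p')"
          have "((p, q, s, t), (p', q', s', t')) \<in> G \<times> G" using g h by simp
          then have "r \<in> B" unfolding B_def r_def by force
          then have "r \<notin> {a<..<b}" using ab by auto
          then consider "r < x" "r < x0" | "x < r" "x0 < r" using x x0 by force
          moreover have diff: "p * z + q - (p' * z + q') = (p - p') * (z - r)" for z
            using False by (simp add: r_def field_simps)
          have "(p - p') * (x0 - r) \<le> 0" using le0 diff[of x0] by simp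
          ultimately have "(p - p') * (x - r) \<le> 0"
            using False by cases (auto simp: mult_le_0_iff)
          then show ?thesis using diff[of x] by simp
        qed (use le0 in simp)
        then show "p * x + q \<le> f x" using h(3) by simp
      qed
      then show ?thesis by blast
    qed auto
  qed
qed

text \<open>
  A segment whose closed interval misses \<open>c\<close> also misses a neighbourhood of \<open>c\<close>; each other one has a
  value above \<open>h\<close> at \<open>c\<close>, hence also nearby.
\<close>
lemma envelope_lower_semicontinuous:
  assumes "segment_envelope X f" "c \<in> X" "h < f c"
  shows "\<forall>\<^sub>F x in nhds c. x \<in> X \<longrightarrow> h < f x"
proof -
  obtain G :: "(real \<times> real \<times> real \<times> real) set" where G: "finite G"
    "\<And>p q s t x. (p, q, s, t) \<in> G \<Longrightarrow> x \<in> {s..t} \<Longrightarrow> f x \<le> p * x + q"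
    "\<And>x. x \<in> X \<Longrightarrow> \<exists>(p, q, s, t)\<in>G. x \<in> {s..t} \<and> f x = p * x + q"
    using assms(1) unfolding segment_envelope_def by fast
  have "\<forall>\<^sub>F x in nhds c. case g of (p, q, s, t) \<Rightarrow> x \<in> {s..t} \<longrightarrow> h < p * x + q" if "g \<in> G" for g
  proof -
    obtain p q s t where g: "g = (p, q, s, t)" by (cases g)
    show ?thesis
    proof (cases "c \<in> {s..t}")
      case True
      then have "h < p * c + q" using G(2)[of p q s t c] that assms(3) g by simp
      moreover have "((\<lambda>x. p * x + q) \<longlongrightarrow> p * c + q) (nhds c)"
        by (intro tendsto_intros filterlim_ident)
      ultimately have "\<forall>\<^sub>F x in nhds c. h < p * x + q" by (rule order_tendstoD(1)[rotated])
      then show ?thesis unfolding g by (auto elim: eventually_mono)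
    next
      case False
      then have "\<forall>\<^sub>F x in nhds c. x \<in> - {s..t}"
        by (intro eventually_nhds_in_open) auto
      then show ?thesis unfolding g by (auto elim: eventually_mono)
    qed
  qed
  then have "\<forall>\<^sub>F x in nhds c. \<forall>g\<in>G. case g of (p, q, s, t) \<Rightarrow> x \<in> {s..t} \<longrightarrow> h < p * x + q"
    using G(1) by (simp add: eventually_ball_finite_distrib)
  then show ?thesis
  proof (rule eventually_mono)
    fix x assume *: "\<forall>g\<in>G. case g of (p, q, s, t) \<Rightarrow> x \<in> {s..t} \<longrightarrow> h < p * x + q"
    show "x \<in> X \<longrightarrow> h < f x"
    proof
      assume "x \<in> X"
      then obtain p q s t where "(p, q, s, t) \<in> G" "x \<in> {s..t}" "f x = p * x + q"
        using G(3)[of x] by auto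
      with * show "h < f x" by force
    qed
  qed
qed

text \<open>
  The breakpoints for \<open>{1 / (n + 2)..1}\<close> are used only up to \<open>1 / (n + 1)\<close>. With all \<open>1 / (n + 1)\<close>
  added to the breakpoints, an interval that avoids them lies between two consecutive such
  numbers, so the finitely many breakpoints of one \<open>n\<close> are enough.
\<close>
lemma locally_finite_breakpoints:
  assumes env: "\<And>e. 0 < e \<Longrightarrow> segment_envelope {e..1} f"
  obtains B where "\<And>a b. {a..b} \<subseteq> {0<..1} \<Longrightarrow> finite (B \<inter> {a..b})"
    "\<And>a b. {a<..<b} \<subseteq> {0<..1} - B \<Longrightarrow> \<exists>p q. \<forall>x\<in>{a<..<b}. f x = p * x + q"
    "\<And>n. 1 / real (Suc n) \<in> B"
proof -
  have "\<exists>D. finite D \<and> (\<forall>a b. {a<..<b} \<subseteq> {1 / real (Suc (Suc n))..1} - D \<longrightarrow>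
      (\<exists>p q. \<forall>x\<in>{a<..<b}. f x = p * x + q))" for n
    by (rule envelope_breakpoints[OF env[of "1 / real (Suc (Suc n))"]]) auto
  then obtain D where D: "\<And>n. finite (D n)"
    "\<And>n a b. {a<..<b} \<subseteq> {1 / real (Suc (Suc n))..1} - D n \<Longrightarrow>
      \<exists>p q. \<forall>x\<in>{a<..<b}. f x = p * x + q" by metis
  define B where "B = range (\<lambda>n. 1 / real (Suc n)) \<union> (\<Union>n. D n \<inter> {..1 / real (Suc n)})"
  show thesis
  proof (rule that[of B])
    show "1 / real (Suc n) \<in> B" for n by (auto simp: B_def)
  next
    fix a b :: real assume ab: "{a..b} \<subseteq> {0<..1}"
    show "finite (B \<inter> {a..b})"
    proof (cases "a \<le> b")
      case True
      then have "0 < a" using ab by auto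
      define N where "N = {n. a \<le> 1 / real (Suc n)}"
      have "N \<subseteq> {.. nat \<lfloor>1 / a\<rfloor>}"
      proof
        fix n assume "n \<in> N"
        then have "real n \<le> 1 / a" using \<open>0 < a\<close> by (simp add: N_def field_simps)
        then show "n \<in> {.. nat \<lfloor>1 / a\<rfloor>}" by (simp add: le_nat_floor)
      qed
      then have "finite N" by (rule finite_subset) simp
      moreover have "B \<inter> {a..b} \<subseteq> (\<lambda>n. 1 / real (Suc n)) ` N \<union> (\<Union>n\<in>N. D n)"
        by (force simp: B_def N_def)
      ultimately show ?thesis using D(1) by (auto intro: finite_subset)
    qed auto
  next
    fix a b :: real assume ab: "{a<..<b} \<subseteq> {0<..1} - B"
    show "\<exists>p q. \<forall>x\<in>{a<..<b}. f x = p * x + q"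
    proof (cases "{a<..<b} = {}")
      case False
      then obtain x where x: "x \<in> {a<..<b}" by blast
      have x01: "0 < x" "x \<le> 1" using x ab by auto
      define m where "m = nat \<lfloor>1 / x\<rfloor>"
      have "1 \<le> 1 / x" using x01 by simp
      then have m: "real m \<le> 1 / x" "1 / x < real m + 1" "1 \<le> m"
        unfolding m_def by linarith+
      then obtain n where n: "m = Suc n" by (cases m) auto
      have notB: "1 / real (Suc i) \<notin> {a<..<b}" for i using ab by (auto simp: B_def)
      have "x \<le> 1 / real (Suc n)" "1 / real (Suc (Suc n)) < x"
        using m x01 by (simp_all add: n field_simps)
      then have "a \<ge> 1 / real (Suc (Suc n))" "b \<le> 1 / real (Suc n)"
        using x notB[of n] notB[of "Suc n"] by auto
      then have "{a<..<b} \<subseteq> {1 / real (Suc (Suc n))..1} - D n"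
        using ab by (fastforce simp: B_def)
      then show ?thesis by (rule D(2))
    qed auto
  qed
qed

lemma continuous_off_breakpoints:
  fixes f :: "real \<Rightarrow> real"
  assumes fin: "\<And>a b. {a..b} \<subseteq> {0<..1} \<Longrightarrow> finite (B \<inter> {a..b})"
    and aff: "\<And>a b. {a<..<b} \<subseteq> {0<..1} - B \<Longrightarrow> \<exists>p q. \<forall>x\<in>{a<..<b}. f x = p * x + q"
    and c: "0 < c" "c < 1" "c \<notin> B"
  shows "isCont f c"
proof -
  have "closed (B \<inter> {c / 2..1})" using c by (intro finite_imp_closed fin) auto
  then have "open ({c / 2<..<1} - B \<inter> {c / 2..1})" by (intro open_Diff) auto
  moreover have "c \<in> {c / 2<..<1} - B \<inter> {c / 2..1}" using c by auto
  ultimately obtain d where d: "0 < d" "ball c d \<subseteq> {c / 2<..<1} - B \<inter> {c / 2..1}"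
    by (meson openE)
  have I: "ball c d = {c - d<..<c + d}" by (auto simp: dist_real_def)
  have "{c - d<..<c + d} \<subseteq> {0<..1} - B" using d(2) c unfolding I by force
  then obtain p q where pq: "\<forall>x\<in>{c - d<..<c + d}. f x = p * x + q" using aff by blast
  have "\<forall>\<^sub>F x in nhds c. x \<in> {c - d<..<c + d}" using d(1) by (intro eventually_nhds_in_open) auto
  then have "\<forall>\<^sub>F x in nhds c. f x = p * x + q" by (rule eventually_mono) (use pq in auto)
  then have "isCont f c \<longleftrightarrow> isCont (\<lambda>x. p * x + q) c" by (rule isCont_cong)
  then show ?thesis by simp
qed

text \<open>
  Below each element of \<open>X\<close> there is a greatest element of \<open>X\<close>; the sequence descends from \<open>1\<close> by
  these steps. It cannot stay above a positive number, as it would meet infinitely many elements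
  of \<open>X\<close> there.
\<close>
lemma decreasing_enumeration:
  fixes X :: "real set"
  assumes X: "X \<subseteq> {0<..1}" "1 \<in> X" and fin: "\<And>a. 0 < a \<Longrightarrow> finite (X \<inter> {a..1})"
    and small: "\<And>a. 0 < a \<Longrightarrow> \<exists>x\<in>X. x < a"
  obtains s :: "nat \<Rightarrow> real" where "s 0 = 1" "\<And>i. s (Suc i) < s i" "s \<longlonglongrightarrow> 0" "X \<subseteq> range s"
proof -
  have next_ex: "\<exists>y\<in>X. y < a \<and> (\<forall>x\<in>X. x < a \<longrightarrow> x \<le> y)" if a: "a \<in> X" for a
  proof -
    obtain x0 where x0: "x0 \<in> X" "x0 < a" using small X a by force
    define Y where "Y = {x\<in>X. x0 \<le> x \<and> x < a}"
    have "Y \<subseteq> X \<inter> {x0..1}" using X by (auto simp: Y_def)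
    moreover have "finite (X \<inter> {x0..1})" using x0 X by (intro fin) auto
    ultimately have Y: "finite Y" by (rule finite_subset)
    have "Y \<noteq> {}" using x0 by (auto simp: Y_def)
    with Y have "Max Y \<in> Y" "\<And>x. x \<in> Y \<Longrightarrow> x \<le> Max Y" by auto
    then show ?thesis unfolding Y_def by (intro bexI[of _ "Max Y"]) (force simp: Y_def)+
  qed
  then obtain \<nu> where \<nu>: "\<And>a. a \<in> X \<Longrightarrow> \<nu> a \<in> X \<and> \<nu> a < a \<and> (\<forall>x\<in>X. x < a \<longrightarrow> x \<le> \<nu> a)"
    by metis
  define s where "s n = (\<nu> ^^ n) 1" for n
  have s: "s 0 = 1" "s (Suc n) = \<nu> (s n)" for n by (simp_all add: s_def)
  have sX: "s n \<in> X" for n by (induction n) (use X(2) \<nu> in \<open>auto simp: s\<close>)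
  have dec: "s (Suc n) < s n" for n using \<nu>[OF sX[of n]] by (simp add: s)
  have "decseq s" using dec by (intro decseq_SucI) (simp add: less_imp_le)
  have below: "\<exists>n. s n < a" if "0 < a" for a
  proof (rule ccontr)
    assume "\<not> (\<exists>n. s n < a)"
    then have "range s \<subseteq> X \<inter> {a..1}" using sX X(1) by (force simp: not_less)
    moreover have "inj s"
    proof (rule linorder_injI)
      fix m n :: nat assume "m < n"
      then have "s n \<le> s (Suc m)" using \<open>decseq s\<close> by (simp add: decseq_def Suc_le_eq)
      then show "s m \<noteq> s n" using dec[of m] by simp
    qed
    ultimately show False using fin[OF that] by (meson finite_subset infinite_UNIV_nat finite_imageD)
  qed
  have "s \<longlonglongrightarrow> 0"
  proof (rule order_tendstoI)
    have "0 < s n" for n using subsetD[OF X(1) sX[of n]] by simp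
    then show "\<forall>\<^sub>F n in sequentially. a < s n" if "a < 0" for a
      using that by (intro always_eventually allI) (rule less_trans)
    fix a :: real assume "0 < a"
    then obtain n where "s n < a" using below by blast
    then show "\<forall>\<^sub>F n in sequentially. s n < a"
      using \<open>decseq s\<close> by (intro eventually_sequentiallyI[of n]) (auto simp: decseq_def intro: le_less_trans)
  qed
  moreover have "X \<subseteq> range s"
  proof
    fix x assume x: "x \<in> X"
    define n where "n = (LEAST n. s n < x)"
    have x01: "0 < x" "x \<le> 1" using subsetD[OF X(1) x] by auto
    have n: "s n < x" unfolding n_def by (rule LeastI_ex[OF below[OF x01(1)]])
    have "n \<noteq> 0" using n x01(2) s(1) by (cases n) auto
    then obtain m where m: "n = Suc m" by (cases n) auto
    have "\<not> s m < x" using not_less_Least[of m "\<lambda>n. s n < x"] m unfolding n_def by simp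
    moreover have "\<not> x < s m" using \<nu>[OF sX[of m]] x n by (auto simp: m s)
    ultimately show "x \<in> range s" by (metis linorder_neqE rangeI)
  qed
  ultimately show thesis using that s(1) dec by blast
qed

section \<open>Continuity and discontinuities\<close>

lemma A_fun_right_continuous:
  assumes "0 < k" "c \<in> {0<..1}"
  shows "continuous (at c within {c..1}) (A_fun k)"
  unfolding continuous_within
proof (rule order_tendstoI)
  fix h assume "h < A_fun k c"
  then have "\<forall>\<^sub>F x in nhds c. x \<in> {c..1} \<longrightarrow> h < A_fun k x"
    using assms by (intro envelope_lower_semicontinuous A_fun_envelope) auto
  then show "\<forall>\<^sub>F x in at c within {c..1}. h < A_fun k x"
    unfolding eventually_at_filter by (rule eventually_mono) auto
next
  fix h assume "A_fun k c < h"
  then have "A_fun k x < h" if "x \<in> {c..1}" for x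
    using monotone_onD[OF A_fun_antimono[OF assms(1)], of c x] assms(2) that by force
  then show "\<forall>\<^sub>F x in at c within {c..1}. A_fun k x < h"
    unfolding eventually_at_filter by (auto intro: always_eventually)
qed

text \<open>
  For \<open>c' \<le> x < c\<close>, the convex combination of \<open>y\<close> and \<open>y'\<close> with capacity \<open>x\<close> bounds the function from
  above, and its cost tends to the optimal cost at \<open>c\<close>. Lower semicontinuity gives the other bound.
\<close>
lemma A_fun_continuous_if_slack:
  fixes V :: "nat set"
  assumes k: "0 < k" and c: "c \<in> {0<..1}" and E: "hypergraph V E" "intersecting k E"
    and y: "feasible_weighting V E c y" "A_fun k c = cost E y"
    and c': "c' < c" "feasible_weighting V E c' y'"
  shows "continuous (at c within {0<..1}) (A_fun k)"
  unfolding continuous_within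
proof (rule order_tendstoI)
  fix h assume "h < A_fun k c"
  then have "\<forall>\<^sub>F x in nhds c. x \<in> {c / 2..1} \<longrightarrow> h < A_fun k x"
    using k c by (intro envelope_lower_semicontinuous A_fun_envelope) auto
  moreover have "\<forall>\<^sub>F x in nhds c. x \<in> {c / 2<..}"
    using c by (intro eventually_nhds_in_open) auto
  ultimately show "\<forall>\<^sub>F x in at c within {0<..1}. h < A_fun k x"
    unfolding eventually_at_filter by eventually_elim auto
next
  fix h assume h: "A_fun k c < h"
  define \<delta> where "\<delta> = cost E (\<lambda>H. y' H - y H)"
  define g where "g x = cost E y + (x - c) / (c' - c) * \<delta>" for x
  have "(g \<longlongrightarrow> cost E y + (c - c) / (c' - c) * \<delta>) (nhds c)"
    unfolding g_def using c'(1) by (intro tendsto_intros filterlim_ident) auto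
  then have "\<forall>\<^sub>F x in nhds c. g x < h"
    by (rule order_tendstoD) (use h y(2) in simp)
  moreover have "\<forall>\<^sub>F x in nhds c. x \<in> {c'<..}"
    using c' by (intro eventually_nhds_in_open) auto
  ultimately show "\<forall>\<^sub>F x in at c within {0<..1}. A_fun k x < h"
    unfolding eventually_at_filter
  proof eventually_elim
    case (elim x)
    show ?case
    proof (intro impI)
      assume x: "x \<in> {0<..1}"
      show "A_fun k x < h"
      proof (cases "x < c")
        case True
        define t where "t = (x - c) / (c' - c)"
        have t: "0 \<le> t" "t \<le> 1" "c + t * (c' - c) = x"
          using True c'(1) elim(2) by (auto simp: t_def field_simps)
        have "feasible_weighting V E x (\<lambda>H. y H + t * (y' H - y H))"
          using feasible_convex_combination[OF y(1) c'(2) t(1,2)] t(3) by simp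
        then have "A_fun k x \<le> cost E (\<lambda>H. y H + t * (y' H - y H))"
          using x k E by (intro A_fun_le_cost) auto
        also have "\<dots> = g x" unfolding cost_affine by (simp add: g_def t_def \<delta>_def)
        finally show ?thesis using elim(1) by simp
      next
        case False
        then show ?thesis using monotone_onD[OF A_fun_antimono[OF k], of c x] c x h by force
      qed
    qed
  qed
qed

theorem theorem1p3:
  fixes k :: nat
  assumes "k \<ge> 2"
  shows "antimono_on {0<..1} (A_fun k)
    \<and> piecewise_linear_on {0<..1} (A_fun k)
    \<and> (\<forall>c\<in>{0<..1}. continuous (at c within {c..1}) (A_fun k))
    \<and> (\<forall>c\<in>{0<..1}. \<not> continuous (at c within {0<..1}) (A_fun k) \<longrightarrow> c \<in> \<rat>)
    \<and> (\<exists>s :: nat \<Rightarrow> real. s 0 = 1 \<and> (\<forall>i. s (Suc i) < s i) \<and> s \<longlonglongrightarrow> 0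
        \<and> {c\<in>{0<..1}. \<not> continuous (at c within {0<..1}) (A_fun k)} \<subseteq> range s)"
proof -
  have k: "0 < k" using assms by simp
  obtain B where B: "\<And>a b. {a..b} \<subseteq> {0<..1} \<Longrightarrow> finite (B \<inter> {a..b})"
    "\<And>a b. {a<..<b} \<subseteq> {0<..1} - B \<Longrightarrow> \<exists>p q. \<forall>x\<in>{a<..<b}. A_fun k x = p * x + q"
    "\<And>n. 1 / real (Suc n) \<in> B"
    using locally_finite_breakpoints[of "A_fun k"] A_fun_envelope k by metis
  have rational: "c \<in> \<rat>"
    if c: "c \<in> {0<..1}" and disc: "\<not> continuous (at c within {0<..1}) (A_fun k)" for c
  proof -
    obtain V :: "nat set" and E y where y: "hypergraph V E" "intersecting k E"
      "feasible_weighting V E c y" "A_fun k c = cost E y"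
      using A_fun_minimiser[of c k] c k by auto
    then have "\<not> feasible_weighting V E c' y'" if "c' < c" for c' y'
      using A_fun_continuous_if_slack[OF k c y that] disc by blast
    then show ?thesis using minimal_capacity_rational y hypergraph_finite by blast
  qed
  obtain s :: "nat \<Rightarrow> real" where s: "s 0 = 1" "\<And>i. s (Suc i) < s i" "s \<longlonglongrightarrow> 0"
    "B \<inter> {0<..1} \<subseteq> range s"
  proof (rule decreasing_enumeration[of "B \<inter> {0<..1}"])
    show "1 \<in> B \<inter> {0<..1}" using B(3)[of 0] by simp
    show "finite (B \<inter> {0<..1} \<inter> {a..1})" if "0 < a" for a
    proof (rule finite_subset)
      show "finite (B \<inter> {a..1})" using that by (intro B(1)) auto
    qed auto
    show "\<exists>x\<in>B \<inter> {0<..1}. x < a" if a: "0 < a" for a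
    proof -
      obtain n where "inverse (real (Suc n)) < a" using reals_Archimedean[OF a] by blast
      then show ?thesis using B(3)[of n]
        by (intro bexI[of _ "1 / real (Suc n)"]) (auto simp: inverse_eq_divide)
    qed
  qed auto
  have "{c\<in>{0<..1}. \<not> continuous (at c within {0<..1}) (A_fun k)} \<subseteq> B \<inter> {0<..1}"
  proof
    fix c assume "c \<in> {c\<in>{0<..1}. \<not> continuous (at c within {0<..1}) (A_fun k)}"
    then have c: "c \<in> {0<..1}" "\<not> continuous (at c within {0<..1}) (A_fun k)" by auto
    have "\<not> isCont (A_fun k) c" using c(2) continuous_at_imp_continuous_within by blast
    then show "c \<in> B \<inter> {0<..1}"
      using continuous_off_breakpoints[OF B(1,2), of c] B(3)[of 0] c(1) by (cases "c = 1") auto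
  qed
  then show ?thesis
    using A_fun_antimono[OF k] A_fun_right_continuous[OF k] rational s B(1,2)
    unfolding piecewise_linear_on_def by blast
qed

end
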